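(* For all positive integers $g$ and $k$, there exists a constellation $\mathcal{C}$ of circles in the plane whose tangency graph $G(\mathcal{C})$ has girth at least $g$ and chromatic number at least $k$.
   Context: A constellation is a finite collection of circles in the plane in which no three circles are tangent at the same point. The tangency graph $G(\mathcal{C})$ of a collection of circles $\mathcal{C}$ is the graph with vertex set $\mathcal{C}$ whose edges are the pairs of tangent circles in $\mathcal{C}$. The girth of a graph is the minimum length of a cycle in it. *)

theory Defs
  imports "HOL-Analysis.Analysis" "HOL-Library.Extended_Nat"
begin

type_synonym plane = "real ^ 2"

definition circle :: "plane set \<Rightarrow> bool" where
  "circle A \<longleftrightarrow> (\<exists>c r. r > 0 \<and> A = sphere c r)"

(* Both internal and external tangency are allowed. A circle is not tangent to itself,
   since circles have positive radius and hence more than one point. *)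
definition tangent_at :: "plane \<Rightarrow> plane set \<Rightarrow> plane set \<Rightarrow> bool" where
  "tangent_at p A B \<longleftrightarrow> circle A \<and> circle B \<and> A \<inter> B = {p}"

definition tangent :: "plane set \<Rightarrow> plane set \<Rightarrow> bool" where
  "tangent A B \<longleftrightarrow> (\<exists>p. tangent_at p A B)"

definition constellation :: "plane set set \<Rightarrow> bool" where
  "constellation \<C> \<longleftrightarrow> finite \<C> \<and> (\<forall>A\<in>\<C>. circle A) \<and>
     \<not> (\<exists>A\<in>\<C>. \<exists>B\<in>\<C>. \<exists>D\<in>\<C>. A \<noteq> B \<and> A \<noteq> D \<and> B \<noteq> D \<and>
         (\<exists>p. tangent_at p A B \<and> tangent_at p A D \<and> tangent_at p B D))"

type_synonym 'a graph = "'a set \<times> 'a set set"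

definition verts :: "'a graph \<Rightarrow> 'a set" where
  "verts G = fst G"

definition edges :: "'a graph \<Rightarrow> 'a set set" where
  "edges G = snd G"

definition tangency_graph :: "plane set set \<Rightarrow> plane set graph" where
  "tangency_graph \<C> = (\<C>, {{A, B} | A B. A \<in> \<C> \<and> B \<in> \<C> \<and> tangent A B})"

(* A cycle is given by the list of its vertices, without repeating the first one at the end;
   the index modulo the length supplies the closing edge. *)
definition is_cycle :: "'a graph \<Rightarrow> 'a list \<Rightarrow> bool" where
  "is_cycle G xs \<longleftrightarrow> length xs \<ge> 3 \<and> distinct xs \<and> set xs \<subseteq> verts G \<and>
     (\<forall>i < length xs. {xs ! i, xs ! (Suc i mod length xs)} \<in> edges G)"

(* The infimum of the empty set is infinity, so acyclic graphs have infinite girth. *)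
definition girth :: "'a graph \<Rightarrow> enat" where
  "girth G = Inf {enat (length xs) | xs. is_cycle G xs}"

definition proper_colouring :: "'a graph \<Rightarrow> nat \<Rightarrow> ('a \<Rightarrow> nat) \<Rightarrow> bool" where
  "proper_colouring G n f \<longleftrightarrow> (\<forall>v \<in> verts G. f v < n) \<and>
     (\<forall>u \<in> verts G. \<forall>v \<in> verts G. {u, v} \<in> edges G \<longrightarrow> f u \<noteq> f v)"

definition chromatic_number :: "'a graph \<Rightarrow> enat" where
  "chromatic_number G = Inf {enat n | n. \<exists>f. proper_colouring G n f}"

end

theory Submission
  imports Defs
begin

text \<open>Call two pairs \<open>(q, r)\<close>, \<open>(q', r')\<close> of a centre and a radius adjacent if \<open>|q - q'| = |r - r'|\<close>. Adding a
  large constant to all radii does not change adjacency, makes all radii positive and rules out external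
  tangency, so that adjacency becomes tangency. Once there are no triangles, the condition on three
  circles touching at one point is void.

  The chromatic number is raised as in the constructions of Tutte and of Nesetril and Rodl. Given a
  configuration of \<open>N\<close> circles that is not \<open>k\<close>-colourable, choose on the \<open>i\<close>-th circle a point \<open>z i\<close> that
  lies on no other circle. By a sparse version of the Hales--Jewett theorem, projected to the complex
  plane with generic complex weights, there is a finite set of points such that every
  \<open>(k + 1)\<close>-colouring makes a similar copy of the points \<open>z i\<close> monochromatic, and these copies form a
  hypergraph of large girth. Put the correspondingly moved configuration of circles through each copy:
  the colour of a monochromatic copy is then unavailable on its circles. The points themselves are
  circles of radius 0, which the inflation makes positive.\<close>

text \<open>A cycle of the new tangency graph either stays inside one copy or runs through points of
  several copies and then traces a cycle of the hypergraph of lines. Girth is therefore inherited as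
  soon as the realization has no accidental adjacencies, and the geometric choices serve this. If
  \<open>z i\<close> lay on a second circle, its image would be adjacent to two circles of one copy.
  If all weights were positive reals, two copies meeting at the image of the same letter would be
  homothetic from that point, and their circles through it would touch there, giving a triangle;
  complex weights rotate the copies apart. In Tutte's construction the edges are all subsets of a
  given size, but here an edge has to be a similar image of one given pattern, so a Ramsey theorem
  for lines takes over from the pigeonhole principle. The lines of the plain theorem may form short
  cycles; the sparse form lifts them to a higher dimension, where they are pulled apart, and
  restores the Ramsey property one point of the original space at a time.\<close>

definition words :: "nat \<Rightarrow> nat \<Rightarrow> nat list set" where
  "words N n = {w. length w = n \<and> set w \<subseteq> {..<N}}"

text \<open>A combinatorial line is a word whose active positions carry \<^term>\<open>None\<close>.\<close>

definition lines :: "nat \<Rightarrow> nat \<Rightarrow> nat option list set" where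
  "lines N n = {\<tau>. length \<tau> = n \<and> None \<in> set \<tau> \<and> set \<tau> \<subseteq> insert None (Some ` {..<N})}"

definition inst :: "nat option list \<Rightarrow> nat \<Rightarrow> nat list" where
  "inst \<tau> a = map (case_option a id) \<tau>"

definition pts :: "nat \<Rightarrow> nat option list \<Rightarrow> nat list set" where
  "pts N \<tau> = inst \<tau> ` {..<N}"

definition mono_line :: "nat \<Rightarrow> (nat list \<Rightarrow> 'c) \<Rightarrow> nat option list \<Rightarrow> bool" where
  "mono_line N c \<tau> \<longleftrightarrow> (\<forall>a<N. \<forall>b<N. c (inst \<tau> a) = c (inst \<tau> b))"

lemma finite_words: "finite (words N n)"
  using finite_lists_length_eq[of "{..<N}" n] by (simp add: words_def conj_commute)

lemma finite_lines: "finite (lines N n)"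
proof -
  have "finite {\<tau>. set \<tau> \<subseteq> insert None (Some ` {..<N}) \<and> length \<tau> = n}"
    by (rule finite_lists_length_eq) auto
  then show ?thesis
    by (rule finite_subset[rotated]) (auto simp: lines_def)
qed

lemma inst_append: "inst (\<sigma> @ \<tau>) a = inst \<sigma> a @ inst \<tau> a"
  by (simp add: inst_def)

lemma inst_map_Some [simp]: "inst (map Some w) a = w"
  by (induction w) (auto simp: inst_def)

lemma length_inst [simp]: "length (inst \<tau> a) = length \<tau>"
  by (simp add: inst_def)

lemma inst_nth: "j < length \<tau> \<Longrightarrow> inst \<tau> a ! j = (case \<tau> ! j of None \<Rightarrow> a | Some b \<Rightarrow> b)"
  by (simp add: inst_def split: option.split)

lemma inst_inj: assumes "None \<in> set \<tau>" "inst \<tau> a = inst \<tau> b" shows "a = b"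
proof -
  obtain j where "j < length \<tau>" "\<tau> ! j = None" using assms(1) by (metis in_set_conv_nth)
  then show ?thesis using inst_nth[of j \<tau>] assms(2) by (metis option.simps(4))
qed

lemma inst_in_words: "\<tau> \<in> lines N n \<Longrightarrow> a < N \<Longrightarrow> inst \<tau> a \<in> words N n"
  by (auto simp: words_def lines_def inst_def split: option.splits)

lemma lines_mono: "N \<le> M \<Longrightarrow> lines N n \<subseteq> lines M n"
  by (auto simp: lines_def subset_iff image_iff)

lemma lines_append: "\<sigma> \<in> lines N n \<Longrightarrow> \<tau> \<in> lines N m \<Longrightarrow> \<sigma> @ \<tau> \<in> lines N (n + m)"
  by (auto simp: lines_def)

lemma lines_append_word: "\<sigma> \<in> lines N n \<Longrightarrow> w \<in> words N m \<Longrightarrow> \<sigma> @ map Some w \<in> lines N (n + m)"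
  by (auto simp: lines_def words_def)

lemma lines_word_append: "\<sigma> \<in> lines N n \<Longrightarrow> w \<in> words N m \<Longrightarrow> map Some w @ \<sigma> \<in> lines N (m + n)"
  by (auto simp: lines_def words_def)

section \<open>The Hales--Jewett theorem\<close>

definition HJ :: "nat \<Rightarrow> bool" where
  "HJ N \<longleftrightarrow> (\<forall>k. \<exists>n. \<forall>c :: nat list \<Rightarrow> nat. (\<forall>x. c x < k) \<longrightarrow>
     (\<exists>\<tau>\<in>lines N n. mono_line N c \<tau>))"

text \<open>Made for product arguments, in which the colour of a prefix is the whole colouring that
  it induces on the suffixes.\<close>

lemma HJ_finite_colours:
  assumes "HJ N" "finite F"
  obtains n where "\<And>c. (\<And>x. c x \<in> F) \<Longrightarrow> \<exists>\<tau>\<in>lines N n. mono_line N c \<tau>"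
proof -
  obtain h :: "'a \<Rightarrow> nat" and k where h: "h ` F = {i. i < k}" "inj_on h F"
    using finite_imp_inj_to_nat_seg[OF assms(2)] by metis
  obtain n where n: "\<forall>c. (\<forall>x. c x < k) \<longrightarrow> (\<exists>\<tau>\<in>lines N n. mono_line N c \<tau>)"
    using assms(1) unfolding HJ_def by metis
  have "\<exists>\<tau>\<in>lines N n. mono_line N c \<tau>" if c: "\<And>x. c x \<in> F" for c
  proof -
    have "\<forall>x. (h \<circ> c) x < k" using c h(1) by auto
    then obtain \<tau> where "\<tau> \<in> lines N n" "mono_line N (h \<circ> c) \<tau>" using n by blast
    then show ?thesis
      using c h(2) unfolding mono_line_def by (metis comp_apply inj_on_eq_iff)
  qed
  then show thesis using that by blast
qed

text \<open>The fan of lines from the colour focusing proof of van der Waerden's theorem. The letter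
  \<open>N\<close> marks the common end point \<open>f\<close>; since \<open>K\<close> is a set, the
  lines of the fan have different colours automatically.\<close>

definition focused :: "nat \<Rightarrow> nat \<Rightarrow> (nat list \<Rightarrow> nat) \<Rightarrow> nat set \<Rightarrow> nat list \<Rightarrow> bool" where
  "focused N n c K f \<longleftrightarrow> f \<in> words (Suc N) n \<and>
     (\<forall>\<kappa>\<in>K. \<exists>\<tau>\<in>lines (Suc N) n. inst \<tau> N = f \<and> (\<forall>a<N. c (inst \<tau> a) = \<kappa>))"

text \<open>Induction on the number \<open>r\<close> of colours in the fan. In front of it
  \<open>m\<close> positions are added, and a prefix is coloured by the colouring it induces on the
  suffixes; \<open>HJ N\<close> gives a line \<open>L\<close> of prefixes along which this is
  constant for letters below \<open>N\<close>. If the focus has the colour of a line of the fan,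
  that line is monochromatic including its end. Otherwise \<open>L\<close> followed by the fixed
  focus is a line in a new colour, and the old lines are made to move along \<open>L\<close> too, so
  that all of them end at the new focus.\<close>

lemma colour_focusing:
  assumes "HJ N" "N > 0"
  shows "\<exists>n. \<forall>c. (\<forall>x. c x < k) \<longrightarrow> (\<exists>\<tau>\<in>lines (Suc N) n. mono_line (Suc N) c \<tau>) \<or>
           (\<exists>K f. K \<subseteq> {..<k} \<and> card K = r \<and> focused N n c K f)"
proof (induction r)
  case 0
  have "focused N 0 c {} []" for c by (simp add: focused_def words_def)
  then show ?case by (metis card.empty empty_subsetI)
next
  case (Suc r)
  then obtain n where n: "\<And>c. (\<forall>x. c x < k) \<Longrightarrow> (\<exists>\<tau>\<in>lines (Suc N) n. mono_line (Suc N) c \<tau>) \<or>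
           (\<exists>K f. K \<subseteq> {..<k} \<and> card K = r \<and> focused N n c K f)" by metis
  have "finite (PiE (words (Suc N) n) (\<lambda>_. {..<k}))" by (simp add: finite_PiE finite_words)
  then obtain m where m: "\<And>c. (\<And>x. c x \<in> PiE (words (Suc N) n) (\<lambda>_. {..<k})) \<Longrightarrow>
      \<exists>\<tau>\<in>lines N m. mono_line N c \<tau>"
    using HJ_finite_colours[OF assms(1)] by metis
  have "(\<exists>\<tau>\<in>lines (Suc N) (m+n). mono_line (Suc N) c \<tau>) \<or>
           (\<exists>K f. K \<subseteq> {..<k} \<and> card K = Suc r \<and> focused N (m+n) c K f)" if c: "\<forall>x. c x < k" for c
  proof -
    have "\<exists>\<tau>\<in>lines N m. mono_line N (\<lambda>x. \<lambda>y\<in>words (Suc N) n. c (x @ y)) \<tau>"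
      by (rule m) (use c in auto)
    then obtain L where L: "L \<in> lines N m"
      and Lm: "mono_line N (\<lambda>x. \<lambda>y\<in>words (Suc N) n. c (x @ y)) L" by blast
    have L': "L \<in> lines (Suc N) m" using L lines_mono[of N "Suc N"] by auto
    have L0: "inst L 0 \<in> words (Suc N) m" using inst_in_words[OF L'] by simp
    have Leq: "c (inst L a @ y) = c (inst L 0 @ y)" if "a < N" "y \<in> words (Suc N) n" for a y
    proof -
      have "(\<lambda>y\<in>words (Suc N) n. c (inst L a @ y)) = (\<lambda>y\<in>words (Suc N) n. c (inst L 0 @ y))"
        using Lm that assms(2) unfolding mono_line_def by blast
      then have "(\<lambda>y\<in>words (Suc N) n. c (inst L a @ y)) y = (\<lambda>y\<in>words (Suc N) n. c (inst L 0 @ y)) y"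
        by (rule fun_cong)
      then show ?thesis using that by simp
    qed
    define c0 where "c0 = (\<lambda>y. c (inst L 0 @ y))"
    have mono_lift: ?thesis if "\<tau> \<in> lines (Suc N) n" "mono_line (Suc N) c0 \<tau>" for \<tau>
    proof -
      have "map Some (inst L 0) @ \<tau> \<in> lines (Suc N) (m+n)"
        using that L0 by (simp add: lines_word_append)
      moreover have "mono_line (Suc N) c (map Some (inst L 0) @ \<tau>)"
        using that unfolding mono_line_def c0_def inst_append inst_map_Some by blast
      ultimately show ?thesis by blast
    qed
    have "\<forall>x. c0 x < k" using c by (simp add: c0_def)
    from n[OF this] consider (mono) "\<exists>\<tau>\<in>lines (Suc N) n. mono_line (Suc N) c0 \<tau>"
      | (foc) K f where "K \<subseteq> {..<k}" "card K = r" "focused N n c0 K f" by blast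
    then show ?thesis
    proof cases
      case mono
      then show ?thesis using mono_lift by blast
    next
      case foc
      have f: "f \<in> words (Suc N) n" using foc(3) by (simp add: focused_def)
      show ?thesis
      proof (cases "c0 f \<in> K")
        case True
        then obtain \<tau> where \<tau>: "\<tau> \<in> lines (Suc N) n" "inst \<tau> N = f" "\<forall>a<N. c0 (inst \<tau> a) = c0 f"
          using foc(3) unfolding focused_def by blast
        then have "mono_line (Suc N) c0 \<tau>" unfolding mono_line_def
          by (metis less_Suc_eq)
        then show ?thesis using \<tau> mono_lift by blast
      next
        case False
        have "focused N (m+n) c (insert (c0 f) K) (inst L N @ f)"
          unfolding focused_def
        proof (intro conjI ballI)
          show "inst L N @ f \<in> words (Suc N) (m + n)"
            using f inst_in_words[OF L', of N] by (auto simp: words_def)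
          fix \<kappa> assume "\<kappa> \<in> insert (c0 f) K"
          then consider "\<kappa> = c0 f" | "\<kappa> \<in> K" by blast
          then show "\<exists>\<tau>\<in>lines (Suc N) (m + n). inst \<tau> N = inst L N @ f \<and> (\<forall>a<N. c (inst \<tau> a) = \<kappa>)"
          proof cases
            case 1
            show ?thesis
            proof (rule bexI[of _ "L @ map Some f"], intro conjI allI impI)
              fix a assume "a < N"
              from Leq[OF this f] show "c (inst (L @ map Some f) a) = \<kappa>"
                by (simp add: inst_append c0_def 1)
            qed (use L' f in \<open>auto simp: inst_append lines_append_word\<close>)
          next
            case 2
            then obtain \<tau> where \<tau>: "\<tau> \<in> lines (Suc N) n" "inst \<tau> N = f" "\<forall>a<N. c0 (inst \<tau> a) = \<kappa>"
              using foc(3) unfolding focused_def by blast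
            show ?thesis
            proof (rule bexI[of _ "L @ \<tau>"], intro conjI allI impI)
              fix a assume "a < N"
              then have "c (inst L a @ inst \<tau> a) = c0 (inst \<tau> a)"
                using Leq[of a "inst \<tau> a"] inst_in_words[OF \<tau>(1), of a] by (simp add: c0_def)
              then show "c (inst (L @ \<tau>) a) = \<kappa>" using \<tau>(3) \<open>a < N\<close> by (simp add: inst_append)
            qed (use L' \<tau> in \<open>auto simp: inst_append lines_append\<close>)
          qed
        qed
        moreover have "card (insert (c0 f) K) = Suc r"
          using False foc finite_subset[OF foc(1)] by simp
        moreover have "insert (c0 f) K \<subseteq> {..<k}"
          using foc(1) c by (simp add: c0_def)
        ultimately show ?thesis by blast
      qed
    qed
  qed
  then show ?case by blast
qed

theorem hales_jewett: "HJ N"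
proof (induction N)
  case 0
  have "[None] \<in> lines 0 1" by (simp add: lines_def)
  then show ?case unfolding HJ_def mono_line_def by blast
next
  case (Suc N)
  show ?case
  proof (cases "N = 0")
    case True
    have "[None] \<in> lines 1 1" by (simp add: lines_def)
    moreover have "mono_line 1 c [None]" for c :: "nat list \<Rightarrow> nat" by (simp add: mono_line_def)
    ultimately show ?thesis using True unfolding HJ_def by (metis One_nat_def)
  next
    case False
    show ?thesis unfolding HJ_def
    proof
      fix k
      obtain n where n: "\<And>c. (\<forall>x. c x < k) \<Longrightarrow> (\<exists>\<tau>\<in>lines (Suc N) n. mono_line (Suc N) c \<tau>) \<or>
           (\<exists>K f. K \<subseteq> {..<k} \<and> card K = Suc k \<and> focused N n c K f)"
        using colour_focusing[OF Suc.IH, of k "Suc k"] False by blast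
      \<comment> \<open>A fan of \<open>k + 1\<close> colours cannot exist among \<open>k\<close>
        colours, so focusing must end with a monochromatic line.\<close>
      have K: "card K \<noteq> Suc k" if "K \<subseteq> {..<k}" for K
        using card_mono[OF _ that] by simp
      show "\<exists>n. \<forall>c. (\<forall>x. c x < k) \<longrightarrow> (\<exists>\<tau>\<in>lines (Suc N) n. mono_line (Suc N) c \<tau>)"
      proof (intro exI allI impI)
        fix c :: "nat list \<Rightarrow> nat" assume "\<forall>x. c x < k"
        from n[OF this] K show "\<exists>\<tau>\<in>lines (Suc N) n. mono_line (Suc N) c \<tau>" by metis
      qed
    qed
  qed
qed

section \<open>A sparse Hales--Jewett theorem\<close>

text \<open>A pendant edge: \<open>p\<close> is fixed before \<open>e'\<close>, so the rest of
  \<open>S\<close> hangs on \<open>e\<close> at a single vertex. Edges are indices, so two of them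
  with the same point set still count as different.\<close>

definition leaf :: "('e \<Rightarrow> 'p set) \<Rightarrow> 'e set \<Rightarrow> 'e \<Rightarrow> bool" where
  "leaf P S e \<longleftrightarrow> e \<in> S \<and> (\<exists>p. \<forall>e'\<in>S. e' \<noteq> e \<longrightarrow> P e \<inter> P e' \<subseteq> {p})"

text \<open>Equivalently, the hypergraph has no Berge cycle of length at most \<open>s\<close>:
  small subhypergraphs are hyperforests.\<close>

definition sparse :: "('e \<Rightarrow> 'p set) \<Rightarrow> nat \<Rightarrow> 'e set \<Rightarrow> bool" where
  "sparse P s E \<longleftrightarrow> (\<forall>S\<subseteq>E. 2 \<le> card S \<and> card S \<le> s \<longrightarrow>
     (\<exists>e1 e2. e1 \<noteq> e2 \<and> leaf P S e1 \<and> leaf P S e2))"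

lemma card_ge2: "2 \<le> card S \<Longrightarrow> \<exists>x y. x \<in> S \<and> y \<in> S \<and> x \<noteq> y"
  by (metis One_nat_def Suc_1 card_le_Suc0_iff_eq card.infinite not_less_eq_eq zero_le)

lemma sparseI_all_leaves:
  assumes "\<And>e e'. e \<in> E \<Longrightarrow> e' \<in> E \<Longrightarrow> e \<noteq> e' \<Longrightarrow> P e \<inter> P e' \<subseteq> {p e}"
  shows "sparse P s E"
  unfolding sparse_def
proof (intro allI impI)
  fix S assume S: "S \<subseteq> E" "2 \<le> card S \<and> card S \<le> s"
  have "leaf P S e" if "e \<in> S" for e
    using that assms[of e] S(1) unfolding leaf_def by blast
  then show "\<exists>e1 e2. e1 \<noteq> e2 \<and> leaf P S e1 \<and> leaf P S e2"
    using card_ge2[of S] S by blast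
qed

lemma sparse_image:
  assumes "sparse P s E" "inj_on f E" "\<And>e. e \<in> E \<Longrightarrow> Q (f e) = P e"
  shows "sparse Q s (f ` E)"
  unfolding sparse_def
proof (intro allI impI)
  fix S assume S: "S \<subseteq> f ` E" "2 \<le> card S \<and> card S \<le> s"
  then obtain T where T: "T \<subseteq> E" "S = f ` T" by (meson subset_imageE)
  have "card S = card T" using T assms(2) by (metis card_image inj_on_subset)
  then obtain e1 e2 where e: "e1 \<noteq> e2" "leaf P T e1" "leaf P T e2"
    using assms(1) S T unfolding sparse_def by metis
  have "leaf Q S (f x)" if l: "leaf P T x" for x
  proof -
    obtain p where x: "x \<in> T" and p: "\<And>y. y \<in> T \<Longrightarrow> y \<noteq> x \<Longrightarrow> P x \<inter> P y \<subseteq> {p}"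
      using l unfolding leaf_def by blast
    have "Q (f x) \<inter> Q (f y) \<subseteq> {p}" if "y \<in> T" "f y \<noteq> f x" for y
      using p[of y] that x T(1) assms(3)[of x] assms(3)[of y] by auto
    then show ?thesis using x unfolding leaf_def T(2) by blast
  qed
  moreover have "f e1 \<noteq> f e2" using e T assms(2) unfolding leaf_def by (metis in_mono inj_onD)
  ultimately show "\<exists>e1 e2. e1 \<noteq> e2 \<and> leaf Q S e1 \<and> leaf Q S e2" using e by blast
qed

lemma Int_subset_if_notin: "A \<inter> B \<subseteq> {z} \<Longrightarrow> z \<notin> A \<Longrightarrow> A \<inter> B \<subseteq> C"
  by blast

text \<open>Copies \<open>\<phi> e\<close> of a system \<open>P\<close> are glued along its part \<open>V\<close>, one for every edge \<open>e\<close> of \<open>H\<close>.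
  An edge of \<open>P\<close> alone cannot connect two points of \<open>V\<close>, so a cycle through several copies is at
  least twice as long as the cycle of \<open>H\<close> it induces; hence \<open>H\<close> may be less sparse.\<close>

lemma sparse_amalgamation:
  assumes P: "sparse P (Suc s) EP" and H: "sparse H s EH"
    and V: "\<And>\<tau>. \<tau> \<in> EP \<Longrightarrow> P \<tau> \<inter> V \<subseteq> {v \<tau>}"
    and inj: "\<And>e. e \<in> EH \<Longrightarrow> inj_on (\<phi> e) (\<Union>(P ` EP))"
    and cross: "\<And>e e' u u'. e \<in> EH \<Longrightarrow> e' \<in> EH \<Longrightarrow> e \<noteq> e' \<Longrightarrow> u \<in> \<Union>(P ` EP) \<Longrightarrow>
       u' \<in> \<Union>(P ` EP) \<Longrightarrow> \<phi> e u = \<phi> e' u' \<Longrightarrow> u \<in> V \<and> (\<exists>y \<in> H e \<inter> H e'. \<phi> e u = g y)"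
  shows "sparse (\<lambda>(e, \<tau>). \<phi> e ` P \<tau>) (Suc s) (EH \<times> EP)"
  unfolding sparse_def
proof (intro allI impI)
  let ?Q = "\<lambda>(e, \<tau>). \<phi> e ` P \<tau>"
  fix S assume S: "S \<subseteq> EH \<times> EP" "2 \<le> card S \<and> card S \<le> Suc s"
  have finS: "finite S" using S(2) by (metis card.infinite not_numeral_le_zero)
  define E where "E = fst ` S"
  have EH: "E \<subseteq> EH" using S(1) by (auto simp: E_def)
  have cardE: "card E \<le> card S" unfolding E_def using card_image_le finS by blast
  have same: "?Q (e, \<tau>) \<inter> ?Q (e, \<tau>') \<subseteq> {\<phi> e p}"
    if "e \<in> EH" "\<tau> \<in> EP" "\<tau>' \<in> EP" "P \<tau> \<inter> P \<tau>' \<subseteq> {p}" for e \<tau> \<tau>' p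
  proof -
    have "\<phi> e ` (P \<tau> \<inter> P \<tau>') = \<phi> e ` P \<tau> \<inter> \<phi> e ` P \<tau>'"
      by (rule inj_on_image_Int[OF inj[OF that(1)]]) (use that in auto)
    then show ?thesis using that(4) by auto
  qed
  have diff: "\<exists>u \<in> P \<tau> \<inter> V. x = \<phi> e u \<and> x \<in> g ` (H e \<inter> H e')"
    if h: "x \<in> ?Q (e, \<tau>) \<inter> ?Q (e', \<tau>')" "(e, \<tau>) \<in> S" "(e', \<tau>') \<in> S" "e \<noteq> e'" for e e' \<tau> \<tau>' x
  proof -
    obtain u where u: "u \<in> P \<tau>" "x = \<phi> e u" using h(1) by auto
    obtain u' where u': "u' \<in> P \<tau>'" "x = \<phi> e' u'" using h(1) by auto
    have "u \<in> V \<and> (\<exists>y \<in> H e \<inter> H e'. \<phi> e u = g y)"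
      by (rule cross[where u' = u']) (use h u u' S(1) in auto)
    then show ?thesis using u by auto
  qed
  \<comment> \<open>Here one unit of sparsity is gained: if the at most \<open>s + 1\<close> edges
    of \<open>S\<close> lie in fewer copies than there are edges, these are at most \<open>s\<close>
    copies, and the sparsity of \<open>H\<close> suffices.\<close>
  consider "card E = card S" | "card E = 1" | "2 \<le> card E" "card E \<le> s"
  proof -
    have "E \<noteq> {}" using S(2) by (auto simp: E_def)
    then have "card E \<noteq> 0" using finS by (simp add: E_def)
    then show thesis using that cardE S(2) by linarith
  qed
  then show "\<exists>e1 e2. e1 \<noteq> e2 \<and> leaf ?Q S e1 \<and> leaf ?Q S e2"
  proof cases
    case 1
    \<comment> \<open>One edge per copy: each meets the other copies only inside \<open>V\<close>,
      hence in one point, so every edge is a leaf.\<close>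
    then have fst_inj: "inj_on fst S" using finS by (simp add: E_def eq_card_imp_inj_on)
    have "leaf ?Q S (e, \<tau>)" if m: "(e, \<tau>) \<in> S" for e \<tau>
      unfolding leaf_def
    proof (intro conjI exI[of _ "\<phi> e (v \<tau>)"] ballI impI m)
      fix d assume d: "d \<in> S" "d \<noteq> (e, \<tau>)"
      obtain e' \<tau>' where d': "d = (e', \<tau>')" by fastforce
      have "e \<noteq> e'" using d d' m inj_onD[OF fst_inj, of d "(e, \<tau>)"] by auto
      then show "?Q (e, \<tau>) \<inter> ?Q d \<subseteq> {\<phi> e (v \<tau>)}"
        using diff[OF _ m, of _ e' \<tau>'] d d' V[of \<tau>] m S(1) by blast
    qed
    then show ?thesis using card_ge2[of S] S(2) by (metis surj_pair)
  next
    case 2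
    then obtain e where e: "E = {e}" by (auto simp: card_1_singleton_iff)
    define T where "T = snd ` S"
    have ST: "S = Pair e ` T" using e unfolding E_def T_def by force
    then have "card S = card T" by (simp add: card_image inj_on_def)
    moreover have TP: "T \<subseteq> EP" using S(1) by (auto simp: T_def)
    ultimately obtain t1 t2 where t: "t1 \<noteq> t2" "leaf P T t1" "leaf P T t2"
      using P S(2) unfolding sparse_def by metis
    have eH: "e \<in> EH" using EH e by simp
    have "leaf ?Q S (e, t)" if l: "leaf P T t" for t
    proof -
      obtain p where "t \<in> T" "\<And>t'. t' \<in> T \<Longrightarrow> t' \<noteq> t \<Longrightarrow> P t \<inter> P t' \<subseteq> {p}"
        using l unfolding leaf_def by blast
      note p = this
      have "?Q (e, t) \<inter> ?Q (e, t') \<subseteq> {\<phi> e p}" if "t' \<in> T" "t' \<noteq> t" for t'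
        by (rule same[OF eH]) (use p that TP in auto)
      then show ?thesis unfolding leaf_def ST using p(1) by blast
    qed
    then show ?thesis using t by blast
  next
    case 3
    have lift: "\<exists>\<tau>. leaf ?Q S (e, \<tau>)" if l: "leaf H E e" for e
    proof -
      obtain p where eE: "e \<in> E" and p: "\<And>e'. e' \<in> E \<Longrightarrow> e' \<noteq> e \<Longrightarrow> H e \<inter> H e' \<subseteq> {p}"
        using l unfolding leaf_def by blast
      have eH: "e \<in> EH" using EH eE by blast
      define T where "T = {\<tau>. (e, \<tau>) \<in> S}"
      have TP: "T \<subseteq> EP" using S(1) by (auto simp: T_def)
      have other: "?Q (e, \<tau>) \<inter> ?Q (e', \<tau>') \<subseteq> {g p}"
        if "\<tau> \<in> T" "(e', \<tau>') \<in> S" "e \<noteq> e'" for \<tau> e' \<tau>'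
      proof
        fix x assume "x \<in> ?Q (e, \<tau>) \<inter> ?Q (e', \<tau>')"
        then have "x \<in> g ` (H e \<inter> H e')" using diff that by (force simp: T_def)
        moreover have "e' \<in> E" using that by (force simp: E_def)
        ultimately show "x \<in> {g p}" using p that by blast
      qed
      have leafI: "leaf ?Q S (e, t)"
        if "t \<in> T" "\<And>\<tau>. \<tau> \<in> T \<Longrightarrow> \<tau> \<noteq> t \<Longrightarrow> ?Q (e, t) \<inter> ?Q (e, \<tau>) \<subseteq> {z}"
          "\<And>e' \<tau>'. (e', \<tau>') \<in> S \<Longrightarrow> e \<noteq> e' \<Longrightarrow> ?Q (e, t) \<inter> ?Q (e', \<tau>') \<subseteq> {z}" for t z
        unfolding leaf_def
      proof (intro conjI exI[of _ z] ballI impI)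
        show "(e, t) \<in> S" using that(1) by (simp add: T_def)
        fix d assume d: "d \<in> S" "d \<noteq> (e, t)"
        obtain e' \<tau>' where d': "d = (e', \<tau>')" by fastforce
        show "?Q (e, t) \<inter> ?Q d \<subseteq> {z}"
        proof (cases "e' = e")
          case True
          then show ?thesis using that(2)[of \<tau>'] d d' by (simp add: T_def)
        next
          case False
          then show ?thesis using that(3)[of e' \<tau>'] d d' by blast
        qed
      qed
      have finT: "finite T" using finS by (rule finite_surj[of _ _ snd]) (force simp: T_def)
      have "card T \<le> card S"
        using card_inj_on_le[of "Pair e" T S] finS by (auto simp: inj_on_def T_def)
      have "T \<noteq> {}" using eE by (auto simp: E_def T_def)
      then have "card T \<noteq> 0" using finT by simp
      then consider "card T = 1" | "2 \<le> card T" by linarith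
      then show ?thesis
      proof cases
        case 1
        then obtain t where t: "T = {t}" by (auto simp: card_1_singleton_iff)
        have "leaf ?Q S (e, t)" by (rule leafI[of _ "g p"]) (use other t in auto)
        then show ?thesis ..
      next
        case 2
        then obtain t1 t2 where "t1 \<noteq> t2" "leaf P T t1" "leaf P T t2"
          using P TP \<open>card T \<le> card S\<close> S(2) unfolding sparse_def by (metis le_trans)
        then obtain p1 p2 where t: "t1 \<noteq> t2" "t1 \<in> T" "t2 \<in> T"
          and p1: "\<And>t. t \<in> T \<Longrightarrow> t \<noteq> t1 \<Longrightarrow> P t1 \<inter> P t \<subseteq> {p1}"
          and p2: "\<And>t. t \<in> T \<Longrightarrow> t \<noteq> t2 \<Longrightarrow> P t2 \<inter> P t \<subseteq> {p2}"
          unfolding leaf_def by blast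
        have s1: "?Q (e, t1) \<inter> ?Q (e, \<tau>) \<subseteq> {\<phi> e p1}" if "\<tau> \<in> T" "\<tau> \<noteq> t1" for \<tau>
          by (rule same[OF eH]) (use t that TP p1[OF that] in auto)
        have s2: "?Q (e, t2) \<inter> ?Q (e, \<tau>) \<subseteq> {\<phi> e p2}" if "\<tau> \<in> T" "\<tau> \<noteq> t2" for \<tau>
          by (rule same[OF eH]) (use t that TP p2[OF that] in auto)
        \<comment> \<open>Other copies can touch the copy \<open>e\<close> only at
          \<open>g p\<close>. This point spoils at most one of the two leaves \<open>t1\<close>,
          \<open>t2\<close>, unless it lies on both; then it is the very vertex at which
          \<open>t1\<close> hangs. This is why \<open>sparse\<close> asks for two leaves.\<close>
        consider "g p \<notin> ?Q (e, t1)" | "g p \<notin> ?Q (e, t2)" | "g p \<in> ?Q (e, t1)" "g p \<in> ?Q (e, t2)"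
          by argo
        then show ?thesis
        proof cases
          case 1
          have "leaf ?Q S (e, t1)"
          proof (rule leafI[where z = "\<phi> e p1", OF t(2)])
            fix e' \<tau>' assume "(e', \<tau>') \<in> S" "e \<noteq> e'"
            from Int_subset_if_notin[OF other[OF t(2) this] 1]
            show "?Q (e, t1) \<inter> ?Q (e', \<tau>') \<subseteq> {\<phi> e p1}" .
          qed (rule s1)
          then show ?thesis ..
        next
          case 2
          have "leaf ?Q S (e, t2)"
          proof (rule leafI[where z = "\<phi> e p2", OF t(3)])
            fix e' \<tau>' assume "(e', \<tau>') \<in> S" "e \<noteq> e'"
            from Int_subset_if_notin[OF other[OF t(3) this] 2]
            show "?Q (e, t2) \<inter> ?Q (e', \<tau>') \<subseteq> {\<phi> e p2}" .
          qed (rule s2)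
          then show ?thesis ..
        next
          case 3
          then have "g p = \<phi> e p1" using s1[OF t(3) t(1)[symmetric]] by blast
          have "leaf ?Q S (e, t1)"
          proof (rule leafI[where z = "\<phi> e p1", OF t(2)])
            fix e' \<tau>' assume "(e', \<tau>') \<in> S" "e \<noteq> e'"
            from other[OF t(2) this] show "?Q (e, t1) \<inter> ?Q (e', \<tau>') \<subseteq> {\<phi> e p1}"
              unfolding \<open>g p = \<phi> e p1\<close> .
          qed (rule s1)
          then show ?thesis ..
        qed
      qed
    qed
    obtain e1 e2 where e: "e1 \<noteq> e2" "leaf H E e1" "leaf H E e2"
      using H EH 3 unfolding sparse_def by metis
    obtain t1 t2 where "leaf ?Q S (e1, t1)" "leaf ?Q S (e2, t2)"
      using lift[OF e(2)] lift[OF e(3)] by metis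
    moreover have "(e1, t1) \<noteq> (e2, t2)" using e(1) by simp
    ultimately show ?thesis by (intro exI conjI)
  qed
qed

section \<open>Block words: copies of a line system glued along a list of words\<close>

text \<open>\<open>e\<close> is a line whose letters are positions in \<open>vs\<close>. A word
  \<open>u\<close> outside \<open>vs\<close> gets its own image for every \<open>e\<close>, while
  \<open>u = vs ! i\<close> gives the concatenation of the blocks named by \<open>inst e i\<close>,
  which several \<open>e\<close> may share.\<close>

definition block_word :: "'a list list \<Rightarrow> nat option list \<Rightarrow> 'a list \<Rightarrow> 'a list" where
  "block_word vs e u = concat (map (case_option u ((!) vs)) e)"

abbreviation block_line :: "nat list list \<Rightarrow> nat option list \<Rightarrow> nat option list \<Rightarrow> nat option list" where
  "block_line vs e \<tau> \<equiv> block_word (map (map Some) vs) e \<tau>"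

lemma concat_eq_blocks:
  assumes "concat xs = concat ys" "length xs = length ys"
    "\<And>x. x \<in> set xs \<union> set ys \<Longrightarrow> length x = n"
  shows "xs = ys"
proof -
  have "\<forall>(x, y)\<in>set (zip xs ys). length x = length y"
  proof clarify
    fix x y assume "(x, y) \<in> set (zip xs ys)"
    then have "x \<in> set xs" "y \<in> set ys" by (auto dest: set_zip_leftD set_zip_rightD)
    then show "length x = length y" using assms(3) by simp
  qed
  then show ?thesis using concat_eq_concat_iff assms(1,2) by blast
qed

lemma block_word_eqD:
  assumes "block_word vs e u = block_word vs e' u'" "e \<in> lines (length vs) m" "e' \<in> lines (length vs) m"
    "\<forall>v\<in>set vs. length v = n" "length u = n" "length u' = n" "j < m"
  shows "case_option u ((!) vs) (e ! j) = case_option u' ((!) vs) (e' ! j)"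
proof -
  have "map (case_option u ((!) vs)) e = map (case_option u' ((!) vs)) e'"
  proof (rule concat_eq_blocks[where n = n])
    show "concat (map (case_option u ((!) vs)) e) = concat (map (case_option u' ((!) vs)) e')"
      using assms(1) by (simp add: block_word_def)
    show "length (map (case_option u ((!) vs)) e) = length (map (case_option u' ((!) vs)) e')"
      using assms(2,3) by (simp add: lines_def)
    show "length x = n" if "x \<in> set (map (case_option u ((!) vs)) e) \<union> set (map (case_option u' ((!) vs)) e')" for x
      using that assms(2-6) by (auto simp: lines_def split: option.splits)
  qed
  then have "map (case_option u ((!) vs)) e ! j = map (case_option u' ((!) vs)) e' ! j" by (rule arg_cong)
  moreover have "j < length e" "j < length e'" using assms(2,3,7) by (auto simp: lines_def)
  ultimately show ?thesis by simp
qed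

lemma block_word_inj:
  assumes "block_word vs e u = block_word vs e u'" "e \<in> lines (length vs) m"
    "\<forall>v\<in>set vs. length v = n" "length u = n" "length u' = n"
  shows "u = u'"
proof -
  obtain j where "j < m" "e ! j = None"
    using assms(2) by (auto simp: lines_def in_set_conv_nth)
  then show ?thesis
    using block_word_eqD[OF assms(1,2,2,3,4,5), of j] by simp
qed

lemma lines_nth_cases:
  assumes "e \<in> lines N m" "j < m"
  obtains "e ! j = None" | i where "i < N" "e ! j = Some i"
proof -
  have "e ! j \<in> set e" using assms by (simp add: lines_def)
  then have "e ! j \<in> insert None (Some ` {..<N})" using assms(1) unfolding lines_def by blast
  then show thesis using that by auto
qed

text \<open>At a position where \<open>e\<close> and \<open>e'\<close> differ, two constants would
  contradict \<open>distinct vs\<close>, so one of them is active and \<open>u\<close> or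
  \<open>u'\<close> is a block from \<open>vs\<close>. An active position of the other line passes
  this on to the other word.\<close>

lemma block_word_cross:
  assumes eq: "block_word vs e u = block_word vs e' u'"
    and e: "e \<in> lines (length vs) m" "e' \<in> lines (length vs) m" "e \<noteq> e'"
    and vs: "\<forall>v\<in>set vs. length v = n" "distinct vs"
    and u: "length u = n" "length u' = n"
  obtains i i' where "i < length vs" "i' < length vs" "u = vs ! i" "u' = vs ! i'" "inst e i = inst e' i'"
proof -
  note blk = block_word_eqD[OF eq e(1,2) vs(1) u]
  have len: "length e = m" "length e' = m" using e by (auto simp: lines_def)
  obtain j where j: "j < m" "e ! j \<noteq> e' ! j" using e(3) len nth_equalityI by metis
  obtain j1 where j1: "j1 < m" "e ! j1 = None" using e(1) by (auto simp: lines_def in_set_conv_nth)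
  obtain j2 where j2: "j2 < m" "e' ! j2 = None" using e(2) by (auto simp: lines_def in_set_conv_nth)
  have uu: "u = vs ! a" if "e ! l = None" "e' ! l = Some a" "l < m" for a l
    using blk[OF that(3)] that by simp
  have uu': "u' = vs ! a" if "e' ! l = None" "e ! l = Some a" "l < m" for a l
    using blk[OF that(3)] that by simp
  have eq': "u = u'" if "e' ! l = None" "e ! l = None" "l < m" for l
    using blk[OF that(3)] that by simp
  have ss: "a = b" if "e ! l = Some a" "e' ! l = Some b" "l < m" "a < length vs" "b < length vs" for a b l
    using blk[OF that(3)] that vs(2) by (simp add: nth_eq_iff_index_eq)
  have "\<exists>i<length vs. u = vs ! i" if "u' = vs ! i" "i < length vs" for i
    using lines_nth_cases[OF e(2) j1(1)] uu[OF j1(2) _ j1(1)] eq'[OF _ j1(2) j1(1)] that by metis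
  moreover have "\<exists>i<length vs. u' = vs ! i" if "u = vs ! i" "i < length vs" for i
    using lines_nth_cases[OF e(1) j2(1)] uu'[OF j2(2) _ j2(1)] eq'[OF j2(2) _ j2(1)] that by metis
  moreover have "(\<exists>i<length vs. u = vs ! i) \<or> (\<exists>i<length vs. u' = vs ! i)"
    using lines_nth_cases[OF e(1) j(1)] lines_nth_cases[OF e(2) j(1)] j ss uu uu' by metis
  ultimately obtain i i' where i: "i < length vs" "i' < length vs" "u = vs ! i" "u' = vs ! i'"
    by metis
  have "inst e i = inst e' i'"
  proof (rule nth_equalityI)
    fix l assume "l < length (inst e i)"
    then have l: "l < m" using len by simp
    have "vs ! (inst e i ! l) = vs ! (inst e' i' ! l)"
      using blk[OF l] i l len by (simp add: inst_nth split: option.splits)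
    moreover have "inst e i ! l < length vs"
      by (rule lines_nth_cases[OF e(1) l]) (use i l len in \<open>auto simp: inst_nth\<close>)
    moreover have "inst e' i' ! l < length vs"
      by (rule lines_nth_cases[OF e(2) l]) (use i l len in \<open>auto simp: inst_nth\<close>)
    ultimately show "inst e i ! l = inst e' i' ! l"
      using vs(2) by (simp add: nth_eq_iff_index_eq)
  qed (use len in simp)
  then show thesis using that i by blast
qed

text \<open>For different \<open>e\<close>, \<open>e'\<close> the previous analysis would make
  \<open>\<tau>\<close> one of the constant blocks, but a line has an active position.\<close>

lemma block_line_inj:
  assumes eq: "block_line vs e \<tau> = block_line vs e' \<tau>'"
    and e: "e \<in> lines (length vs) m" "e' \<in> lines (length vs) m"
    and vs: "\<forall>v\<in>set vs. length v = n" "distinct vs"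
    and \<tau>: "\<tau> \<in> lines N n" "\<tau>' \<in> lines N n"
  shows "e = e' \<and> \<tau> = \<tau>'"
proof -
  let ?vs = "map (map Some) vs"
  have *: "\<forall>v\<in>set ?vs. length v = n" "distinct ?vs" "length \<tau> = n" "length \<tau>' = n"
    using vs \<tau> by (auto simp: distinct_map lines_def inj_on_def)
  have e': "e \<in> lines (length ?vs) m" "e' \<in> lines (length ?vs) m" using e by auto
  have "e = e'"
  proof (rule ccontr)
    assume "e \<noteq> e'"
    then obtain i where "i < length ?vs" "\<tau> = ?vs ! i"
      using block_word_cross[OF eq e' _ *] by metis
    then have "None \<notin> set \<tau>" by auto
    then show False using \<tau> by (simp add: lines_def)
  qed
  then show ?thesis using block_word_inj[OF _ e'(1) *(1,3,4)] eq by blast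
qed

lemma length_concat_const: "(\<And>x. x \<in> set xs \<Longrightarrow> length x = n) \<Longrightarrow> length (concat xs) = length xs * n"
  by (induction xs) auto

lemma block_line_in_lines:
  assumes "e \<in> lines (length vs) m" "set vs \<subseteq> words N n" "\<tau> \<in> lines N n"
  shows "block_line vs e \<tau> \<in> lines N (m * n)"
proof -
  let ?f = "case_option \<tau> ((!) (map (map Some) vs))"
  have blk: "?f x = \<tau> \<or> (\<exists>v\<in>words N n. ?f x = map Some v)" if "x \<in> set e" for x
  proof (cases x)
    case (Some i)
    then have i: "i < length vs" using that assms(1) by (force simp: lines_def)
    then have "vs ! i \<in> words N n" using assms(2) nth_mem by blast
    then show ?thesis using Some i by auto
  qed simp
  have "length (?f x) = n" if "x \<in> set e" for x
    using blk[OF that] assms(3) by (auto simp: lines_def words_def)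
  then have "length (concat (map ?f e)) = m * n"
    using assms(1) length_concat_const[of "map ?f e" n] by (auto simp: lines_def)
  moreover have "None \<in> set (concat (map ?f e))"
    using assms(1,3) by (force simp: lines_def)
  moreover have "set (concat (map ?f e)) \<subseteq> insert None (Some ` {..<N})"
  proof
    fix y assume "y \<in> set (concat (map ?f e))"
    then obtain x where "x \<in> set e" "y \<in> set (?f x)" by auto
    then show "y \<in> insert None (Some ` {..<N})"
      using blk[of x] assms(3) by (auto simp: lines_def words_def subset_iff image_iff)
  qed
  ultimately show ?thesis by (simp add: lines_def block_word_def)
qed

lemma inst_block_line:
  assumes "e \<in> lines (length vs) m"
  shows "inst (block_line vs e \<tau>) a = block_word vs e (inst \<tau> a)"
proof -
  have "map (case_option a id) (case_option \<tau> ((!) (map (map Some) vs)) x) = case_option (inst \<tau> a) ((!) vs) x"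
    if "x \<in> set e" for x
  proof (cases x)
    case (Some i)
    then have "i < length vs" using that assms by (force simp: lines_def)
    then show ?thesis using Some inst_map_Some[of "vs ! i" a] by (simp add: inst_def)
  qed (simp add: inst_def)
  then have "map (\<lambda>x. map (case_option a id) (case_option \<tau> ((!) (map (map Some) vs)) x)) e
      = map (case_option (inst \<tau> a) ((!) vs)) e" by simp
  moreover have "inst (block_line vs e \<tau>) a
      = concat (map (\<lambda>x. map (case_option a id) (case_option \<tau> ((!) (map (map Some) vs)) x)) e)"
    unfolding inst_def block_word_def map_concat map_map comp_def ..
  ultimately show ?thesis by (simp only: block_word_def)
qed

section \<open>Partite systems and the sparse theorem\<close>

definition sparse_HJ :: "nat \<Rightarrow> bool" where
  "sparse_HJ s \<longleftrightarrow> (\<forall>N k. \<exists>n L. L \<subseteq> lines N n \<and> sparse (pts N) s L \<and>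
     (\<forall>c :: nat list \<Rightarrow> nat. (\<forall>x. c x < k) \<longrightarrow> (\<exists>\<tau>\<in>L. mono_line N c \<tau>)))"

text \<open>A system of lines in dimension \<open>n\<close> lying over the full Hales--Jewett space of dimension \<open>n0\<close>
  via \<open>\<pi>\<close>, whose colourings can be made to depend on the projection only at the points over \<open>U\<close>.\<close>

definition partite :: "nat \<Rightarrow> nat \<Rightarrow> nat \<Rightarrow> nat \<Rightarrow> nat list set \<Rightarrow> nat \<Rightarrow> nat option list set \<Rightarrow>
    (nat list \<Rightarrow> nat list) \<Rightarrow> bool" where
  "partite s N k n0 U n L \<pi> \<longleftrightarrow> L \<subseteq> lines N n \<and> sparse (pts N) s L \<and>
     (\<forall>\<tau>\<in>L. \<exists>\<sigma>\<in>lines N n0. \<forall>a<N. \<pi> (inst \<tau> a) = inst \<sigma> a) \<and>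
     (\<forall>c :: nat list \<Rightarrow> nat. (\<forall>x. c x < k) \<longrightarrow>
       (\<exists>\<psi>. (\<forall>x. \<psi> x < k) \<and> (\<forall>\<sigma>\<in>lines N n0. \<exists>\<tau>\<in>L. \<forall>a<N.
          \<pi> (inst \<tau> a) = inst \<sigma> a \<and> (inst \<sigma> a \<in> U \<longrightarrow> c (inst \<tau> a) = \<psi> (inst \<sigma> a)))))"

text \<open>The suffix of \<open>separated \<sigma>\<close> is constant along the line and determines \<open>\<sigma>\<close>, so that different lines
  become disjoint.\<close>

definition separated :: "nat option list \<Rightarrow> nat option list" where
  "separated \<sigma> = \<sigma> @ map Some (map (case_option 1 (\<lambda>_. 0)) \<sigma> @ inst \<sigma> 0)"

lemma separated_inst_eqD:
  assumes "inst (separated \<sigma>) a = inst (separated \<tau>) b" "length \<sigma> = length \<tau>"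
  shows "\<sigma> = \<tau>"
proof (rule nth_equalityI)
  have eq: "map (case_option 1 (\<lambda>_. 0)) \<sigma> = (map (case_option 1 (\<lambda>_. 0)) \<tau> :: nat list)"
    "inst \<sigma> 0 = inst \<tau> 0"
    using assms by (auto simp: separated_def inst_append simp del: map_append)
  fix j assume j: "j < length \<sigma>"
  have "(case_option 1 (\<lambda>_. 0) (\<sigma> ! j) :: nat) = case_option 1 (\<lambda>_. 0) (\<tau> ! j)"
    using eq(1) j assms(2) by (metis nth_map)
  moreover have "case_option 0 id (\<sigma> ! j) = (case_option 0 id (\<tau> ! j) :: nat)"
    using eq(2) j assms(2) unfolding inst_def by (metis nth_map)
  ultimately show "\<sigma> ! j = \<tau> ! j" by (simp split: option.splits)
qed (use assms in simp)

text \<open>With \<open>U\<close> empty colours do not matter and it suffices to lift every line;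
  the lifts are disjoint, hence sparse to any order. The suffix uses the letters 0 and 1, whence
  \<open>N \<ge> 2\<close>.\<close>

lemma partite_base:
  assumes "N \<ge> 2"
  shows "\<exists>n L \<pi>. partite s N k n0 {} n L \<pi>"
proof -
  define L where "L = separated ` lines N n0"
  have "separated \<sigma> \<in> lines N (n0 + (n0 + n0))" if "\<sigma> \<in> lines N n0" for \<sigma>
  proof -
    have "map (case_option 1 (\<lambda>_. 0)) \<sigma> @ inst \<sigma> 0 \<in> words N (n0 + n0)"
      using inst_in_words[OF that, of 0] that assms
      by (auto simp: words_def lines_def split: option.splits)
    then show ?thesis unfolding separated_def using that lines_append_word by blast
  qed
  then have L: "L \<subseteq> lines N (n0 + (n0 + n0))" by (auto simp: L_def)
  have proj: "take n0 (inst (separated \<sigma>) a) = inst \<sigma> a" if "\<sigma> \<in> lines N n0" for \<sigma> a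
    using that by (simp add: separated_def inst_append lines_def)
  have "pts N \<tau> \<inter> pts N \<tau>' = {}" if "\<tau> \<in> L" "\<tau>' \<in> L" "\<tau> \<noteq> \<tau>'" for \<tau> \<tau>'
    using that separated_inst_eqD by (force simp: L_def pts_def lines_def)
  then have "sparse (pts N) s L" by (intro sparseI_all_leaves) blast
  moreover have "\<exists>\<psi>. (\<forall>x. \<psi> x < k) \<and> (\<forall>\<sigma>\<in>lines N n0. \<exists>\<tau>\<in>L. \<forall>a<N.
          take n0 (inst \<tau> a) = inst \<sigma> a \<and> (inst \<sigma> a \<in> {} \<longrightarrow> c (inst \<tau> a) = \<psi> (inst \<sigma> a)))"
    if "\<forall>x. c x < k" for c :: "nat list \<Rightarrow> nat"
    using that proj by (intro exI[of _ c]) (auto simp: L_def)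
  ultimately have "partite s N k n0 {} (n0 + (n0 + n0)) L (take n0)"
    unfolding partite_def using L proj by (auto simp: L_def)
  then show ?thesis by blast
qed

lemma glue_maps:
  assumes "\<And>e e' u u'. e \<in> E \<Longrightarrow> e' \<in> E \<Longrightarrow> u \<in> A \<Longrightarrow> u' \<in> A \<Longrightarrow> \<phi> e u = \<phi> e' u' \<Longrightarrow> f u = f u'"
  shows "\<exists>h. \<forall>e\<in>E. \<forall>u\<in>A. h (\<phi> e u) = f u"
proof -
  define h where "h x = f (SOME u. u \<in> A \<and> (\<exists>e\<in>E. x = \<phi> e u))" for x
  have "h (\<phi> e u) = f u" if "e \<in> E" "u \<in> A" for e u
  proof -
    let ?P = "\<lambda>u'. u' \<in> A \<and> (\<exists>e'\<in>E. \<phi> e u = \<phi> e' u')"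
    have "?P (Eps ?P)" by (rule someI[of ?P u]) (use that in auto)
    then show ?thesis unfolding h_def using assms that by metis
  qed
  then show ?thesis by blast
qed

text \<open>The points over \<open>w\<close> form \<open>V\<close>. The weaker sparse theorem, with
  the elements of \<open>V\<close> as letters, provides \<open>EH\<close> such that for some
  \<open>e\<close> in it the colouring \<open>c\<close> is constant on the copy of \<open>V\<close>;
  the property for \<open>U\<close>, applied to this copy of the old system, handles the points over
  \<open>U\<close>. A line meets \<open>V\<close> at most once because \<open>\<pi>\<close> is
  injective along it, so the amalgam is again \<open>Suc s\<close>-sparse although \<open>EH\<close>
  is only \<open>s\<close>-sparse.\<close>

lemma partite_step:
  assumes P: "partite (Suc s) N k n0 U n L \<pi>" and H: "sparse_HJ s"
  shows "\<exists>n' L' \<pi>'. partite (Suc s) N k n0 (insert w U) n' L' \<pi>'"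
proof -
  have L: "L \<subseteq> lines N n" and spL: "sparse (pts N) (Suc s) L"
    and proj: "\<And>\<tau>. \<tau> \<in> L \<Longrightarrow> \<exists>\<sigma>\<in>lines N n0. \<forall>a<N. \<pi> (inst \<tau> a) = inst \<sigma> a"
    and col: "\<And>c :: nat list \<Rightarrow> nat. (\<forall>x. c x < k) \<Longrightarrow>
       (\<exists>\<psi>. (\<forall>x. \<psi> x < k) \<and> (\<forall>\<sigma>\<in>lines N n0. \<exists>\<tau>\<in>L. \<forall>a<N.
          \<pi> (inst \<tau> a) = inst \<sigma> a \<and> (inst \<sigma> a \<in> U \<longrightarrow> c (inst \<tau> a) = \<psi> (inst \<sigma> a))))"
    using P unfolding partite_def by auto
  define A where "A = \<Union>(pts N ` L)"
  define V where "V = {x \<in> A. \<pi> x = w}"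
  have Aw: "A \<subseteq> words N n" using L inst_in_words by (fastforce simp: A_def pts_def)
  then have "finite V" using finite_words finite_subset by (fastforce simp: V_def)
  then obtain vs where vs: "set vs = V" "distinct vs" using finite_distinct_list by blast
  obtain m EH where EH: "EH \<subseteq> lines (length vs) m" and spH: "sparse (pts (length vs)) s EH"
    and colH: "\<And>c :: nat list \<Rightarrow> nat. (\<forall>x. c x < k) \<Longrightarrow> \<exists>e\<in>EH. mono_line (length vs) c e"
    using H unfolding sparse_HJ_def by metis
  have vslen: "\<forall>v\<in>set vs. length v = n"
    using vs(1) Aw by (auto simp: V_def words_def)
  have Alen: "\<And>u. u \<in> A \<Longrightarrow> length u = n" using Aw by (auto simp: words_def)
  let ?\<phi> = "block_word vs"
  have cross: "u \<in> V \<and> u' \<in> V \<and> (\<exists>y \<in> pts (length vs) e \<inter> pts (length vs) e'. ?\<phi> e u = concat (map ((!) vs) y))"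
    if "e \<in> EH" "e' \<in> EH" "e \<noteq> e'" "u \<in> A" "u' \<in> A" "?\<phi> e u = ?\<phi> e' u'" for e e' u u'
  proof -
    have "e \<in> lines (length vs) m" "e' \<in> lines (length vs) m" using that EH by auto
    from block_word_cross[OF that(6) this that(3) vslen vs(2) Alen[OF that(4)] Alen[OF that(5)]]
    obtain i i' where i: "i < length vs" "i' < length vs" "u = vs ! i" "u' = vs ! i'" "inst e i = inst e' i'"
      by metis
    have "?\<phi> e u = concat (map ((!) vs) (inst e i))"
      unfolding block_word_def inst_def i(3) by (simp add: option.case_distrib comp_def cong: option.case_cong)
    moreover have "inst e i \<in> pts (length vs) e \<inter> pts (length vs) e'"
    proof -
      have "inst e i \<in> pts (length vs) e" "inst e' i' \<in> pts (length vs) e'"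
        using i(1,2) by (auto simp: pts_def)
      then show ?thesis using i(5) by simp
    qed
    moreover have "u \<in> V" "u' \<in> V" using i vs(1) nth_mem by blast+
    ultimately show ?thesis by blast
  qed
  have inj: "inj_on (?\<phi> e) A" if "e \<in> EH" for e
    using block_word_inj[OF _ _ vslen] Alen that EH by (meson inj_onI subsetD)
  have V1: "\<exists>v. pts N \<tau> \<inter> V \<subseteq> {v}" if \<tau>: "\<tau> \<in> L" for \<tau>
  proof -
    obtain \<sigma> where \<sigma>: "\<sigma> \<in> lines N n0" "\<forall>a<N. \<pi> (inst \<tau> a) = inst \<sigma> a" using proj[OF \<tau>] by blast
    have "a = b" if "a < N" "b < N" "inst \<tau> a \<in> V" "inst \<tau> b \<in> V" for a b
    proof -
      have "inst \<sigma> a = inst \<sigma> b" using that \<sigma>(2) by (auto simp: V_def)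
      then show ?thesis using inst_inj \<sigma>(1) by (auto simp: lines_def)
    qed
    then show ?thesis unfolding pts_def by blast
  qed
  then obtain v where v: "\<And>\<tau>. \<tau> \<in> L \<Longrightarrow> pts N \<tau> \<inter> V \<subseteq> {v \<tau>}" by metis
  have sp: "sparse (\<lambda>(e, \<tau>). ?\<phi> e ` pts N \<tau>) (Suc s) (EH \<times> L)"
    by (rule sparse_amalgamation[OF spL spH v, where g = "\<lambda>y. concat (map ((!) vs) y)"])
      (use cross inj in \<open>auto simp: A_def\<close>)
  define L' where "L' = (\<lambda>(e, \<tau>). block_line vs e \<tau>) ` (EH \<times> L)"
  have instL': "inst (block_line vs e \<tau>) a = ?\<phi> e (inst \<tau> a)" if "e \<in> EH" for e \<tau> a
    using inst_block_line that EH by blast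
  have "sparse (pts N) (Suc s) L'"
    unfolding L'_def
  proof (rule sparse_image[OF sp])
    show "inj_on (\<lambda>(e, \<tau>). block_line vs e \<tau>) (EH \<times> L)"
    proof (rule inj_onI, clarify)
      fix e \<tau> e' \<tau>' assume *: "e \<in> EH" "e' \<in> EH" "\<tau> \<in> L" "\<tau>' \<in> L" "block_line vs e \<tau> = block_line vs e' \<tau>'"
      show "e = e' \<and> \<tau> = \<tau>'"
        by (rule block_line_inj[OF *(5) _ _ vslen vs(2)]) (use * EH L in auto)
    qed
  qed (auto simp: pts_def instL' image_image)
  moreover have "L' \<subseteq> lines N (m * n)"
  proof -
    have "set vs \<subseteq> words N n" using vs(1) Aw by (auto simp: V_def)
    then have "block_line vs e \<tau> \<in> lines N (m * n)" if "e \<in> EH" "\<tau> \<in> L" for e \<tau>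
      using block_line_in_lines that EH L by blast
    then show ?thesis by (auto simp: L'_def)
  qed
  moreover obtain \<pi>' where \<pi>': "\<And>e u. e \<in> EH \<Longrightarrow> u \<in> A \<Longrightarrow> \<pi>' (?\<phi> e u) = \<pi> u"
  proof -
    have "\<pi> u = \<pi> u'" if h: "e \<in> EH" "e' \<in> EH" "u \<in> A" "u' \<in> A" "?\<phi> e u = ?\<phi> e' u'" for e e' u u'
    proof (cases "e = e'")
      case True
      then show ?thesis using inj[OF h(1)] h by (auto dest: inj_onD)
    next
      case False
      then show ?thesis using cross[OF h(1,2) _ h(3,4,5)] by (simp add: V_def)
    qed
    then have "\<exists>h. \<forall>e\<in>EH. \<forall>u\<in>A. h (?\<phi> e u) = \<pi> u" by (rule glue_maps)
    then show thesis using that by blast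
  qed
  have instA: "inst \<tau> a \<in> A" if "\<tau> \<in> L" "a < N" for \<tau> a
    using that by (auto simp: A_def pts_def)
  have "\<exists>\<sigma>\<in>lines N n0. \<forall>a<N. \<pi>' (inst \<rho> a) = inst \<sigma> a" if "\<rho> \<in> L'" for \<rho>
  proof -
    obtain e \<tau> where e: "e \<in> EH" "\<tau> \<in> L" "\<rho> = block_line vs e \<tau>" using \<open>\<rho> \<in> L'\<close> by (auto simp: L'_def)
    show ?thesis using proj[OF e(2)] by (simp add: e instL' \<pi>' instA)
  qed
  moreover have "\<exists>\<psi>. (\<forall>x. \<psi> x < k) \<and> (\<forall>\<sigma>\<in>lines N n0. \<exists>\<tau>\<in>L'. \<forall>a<N.
          \<pi>' (inst \<tau> a) = inst \<sigma> a \<and> (inst \<sigma> a \<in> insert w U \<longrightarrow> c (inst \<tau> a) = \<psi> (inst \<sigma> a)))"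
    if c: "\<forall>x. c x < k" for c :: "nat list \<Rightarrow> nat"
  proof -
    obtain e where e: "e \<in> EH" and em: "mono_line (length vs) (\<lambda>y. c (concat (map ((!) vs) y))) e"
      using colH[of "\<lambda>y. c (concat (map ((!) vs) y))"] c by blast
    have eV: "c (?\<phi> e x) = c (?\<phi> e y)" if "x \<in> V" "y \<in> V" for x y
    proof -
      have *: "?\<phi> e (vs ! i) = concat (map ((!) vs) (inst e i))" for i
        unfolding block_word_def inst_def by (simp add: option.case_distrib comp_def cong: option.case_cong)
      obtain i i' where i: "i < length vs" "i' < length vs" "x = vs ! i" "y = vs ! i'"
        using \<open>x \<in> V\<close> \<open>y \<in> V\<close> vs(1) by (metis in_set_conv_nth)
      then have "c (concat (map ((!) vs) (inst e i))) = c (concat (map ((!) vs) (inst e i')))"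
        using em unfolding mono_line_def by blast
      then show ?thesis by (simp only: i *)
    qed
    obtain \<psi> where \<psi>: "\<And>x. \<psi> x < k" and
      \<psi>': "\<And>\<sigma>. \<sigma> \<in> lines N n0 \<Longrightarrow> \<exists>\<tau>\<in>L. \<forall>a<N. \<pi> (inst \<tau> a) = inst \<sigma> a \<and>
          (inst \<sigma> a \<in> U \<longrightarrow> c (?\<phi> e (inst \<tau> a)) = \<psi> (inst \<sigma> a))"
    proof -
      have "\<forall>x. c (?\<phi> e x) < k" using c by simp
      from col[OF this] that show thesis by blast
    qed
    \<comment> \<open>If no line has a point over \<open>w\<close>, the value at \<open>w\<close> is
      free but must stay below \<open>k\<close>.\<close>
    define \<kappa> where "\<kappa> = (if V = {} then \<psi> w else c (?\<phi> e (SOME x. x \<in> V)))"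
    have \<kappa>: "c (?\<phi> e x) = \<kappa>" if "x \<in> V" for x
    proof -
      have "(SOME x. x \<in> V) \<in> V" using that by (rule someI)
      then show ?thesis using eV[OF that] that by (auto simp: \<kappa>_def)
    qed
    have "(\<psi>(w := \<kappa>)) x < k" for x using c \<psi> by (simp add: \<kappa>_def)
    moreover have "\<exists>\<tau>\<in>L'. \<forall>a<N. \<pi>' (inst \<tau> a) = inst \<sigma> a \<and>
        (inst \<sigma> a \<in> insert w U \<longrightarrow> c (inst \<tau> a) = (\<psi>(w := \<kappa>)) (inst \<sigma> a))"
      if \<sigma>: "\<sigma> \<in> lines N n0" for \<sigma>
    proof -
      obtain \<tau> where \<tau>: "\<tau> \<in> L" "\<And>a. a < N \<Longrightarrow> \<pi> (inst \<tau> a) = inst \<sigma> a"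
          "\<And>a. a < N \<Longrightarrow> inst \<sigma> a \<in> U \<Longrightarrow> c (?\<phi> e (inst \<tau> a)) = \<psi> (inst \<sigma> a)"
        using \<psi>'[OF \<sigma>] by blast
      show ?thesis
      proof (rule bexI[of _ "block_line vs e \<tau>"], intro allI impI conjI)
        show "block_line vs e \<tau> \<in> L'" using e \<tau>(1) by (auto simp: L'_def)
        fix a assume a: "a < N"
        show "\<pi>' (inst (block_line vs e \<tau>) a) = inst \<sigma> a"
          by (simp add: instL' e \<pi>' instA \<tau> a)
        assume U: "inst \<sigma> a \<in> insert w U"
        show "c (inst (block_line vs e \<tau>) a) = (\<psi>(w := \<kappa>)) (inst \<sigma> a)"
        proof (cases "inst \<sigma> a = w")
          case True
          then have "inst \<tau> a \<in> V" using \<tau>(2)[OF a] instA[OF \<tau>(1) a] by (simp add: V_def)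
          then show ?thesis using \<kappa> True by (simp add: instL' e)
        next
          case False
          then show ?thesis using \<tau>(3)[OF a] U by (simp add: instL' e)
        qed
      qed
    qed
    ultimately show ?thesis by blast
  qed
  ultimately have "partite (Suc s) N k n0 (insert w U) (m * n) L' \<pi>'"
    unfolding partite_def by blast
  then show ?thesis by blast
qed

text \<open>The words of the full space enter \<open>U\<close> one at a time. Once all are in,
  \<open>\<psi>\<close> colours the full space, the plain theorem finds a monochromatic
  \<open>\<sigma>\<close>, and its lift is monochromatic for \<open>c\<close>. With fewer than two
  letters a line has at most one point, so sparsity is automatic.\<close>

theorem sparse_hales_jewett: "sparse_HJ s"
proof (induction s)
  case 0
  show ?case unfolding sparse_HJ_def
  proof (intro allI)
    fix N k
    obtain n where "\<forall>c :: nat list \<Rightarrow> nat. (\<forall>x. c x < k) \<longrightarrow> (\<exists>\<tau>\<in>lines N n. mono_line N c \<tau>)"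
      using hales_jewett[of N] unfolding HJ_def by metis
    moreover have "sparse (pts N) 0 (lines N n)" by (auto simp: sparse_def)
    ultimately show "\<exists>n L. L \<subseteq> lines N n \<and> sparse (pts N) 0 L \<and>
     (\<forall>c :: nat list \<Rightarrow> nat. (\<forall>x. c x < k) \<longrightarrow> (\<exists>\<tau>\<in>L. mono_line N c \<tau>))" by blast
  qed
next
  case (Suc s)
  show ?case unfolding sparse_HJ_def
  proof (intro allI)
    fix N k
    obtain n0 where n0: "\<And>c :: nat list \<Rightarrow> nat. (\<forall>x. c x < k) \<Longrightarrow> \<exists>\<tau>\<in>lines N n0. mono_line N c \<tau>"
      using hales_jewett[of N] unfolding HJ_def by metis
    show "\<exists>n L. L \<subseteq> lines N n \<and> sparse (pts N) (Suc s) L \<and>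
     (\<forall>c :: nat list \<Rightarrow> nat. (\<forall>x. c x < k) \<longrightarrow> (\<exists>\<tau>\<in>L. mono_line N c \<tau>))"
    proof (cases "N \<ge> 2")
      case False
      have "pts N \<tau> \<inter> pts N \<tau>' \<subseteq> {inst \<tau> 0}" for \<tau> \<tau>'
      proof -
        have "a = 0" if "a < N" for a using that False by linarith
        then show ?thesis by (auto simp: pts_def)
      qed
      then have "sparse (pts N) (Suc s) (lines N n0)" by (intro sparseI_all_leaves)
      then show ?thesis using n0 by blast
    next
      case True
      have "\<exists>n L \<pi>. partite (Suc s) N k n0 U n L \<pi>" if "finite U" for U
        using that
      proof induction
        case empty
        then show ?case by (rule partite_base[OF True])
      next
        case (insert w U)
        then show ?case using partite_step[OF _ Suc.IH] by blast
      qed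
      then obtain n L \<pi> where P: "partite (Suc s) N k n0 (words N n0) n L \<pi>"
        using finite_words by blast
      have "\<exists>\<tau>\<in>L. mono_line N c \<tau>" if "\<forall>x. c x < k" for c :: "nat list \<Rightarrow> nat"
      proof -
        obtain \<psi> where \<psi>: "\<forall>x. \<psi> x < k" and \<psi>': "\<And>\<sigma>. \<sigma> \<in> lines N n0 \<Longrightarrow> \<exists>\<tau>\<in>L. \<forall>a<N.
           \<pi> (inst \<tau> a) = inst \<sigma> a \<and> (inst \<sigma> a \<in> words N n0 \<longrightarrow> c (inst \<tau> a) = \<psi> (inst \<sigma> a))"
          using P \<open>\<forall>x. c x < k\<close> unfolding partite_def by metis
        obtain \<sigma> where \<sigma>: "\<sigma> \<in> lines N n0" "mono_line N \<psi> \<sigma>" using n0[OF \<psi>] by blast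
        then obtain \<tau> where "\<tau> \<in> L" "\<forall>a<N. c (inst \<tau> a) = \<psi> (inst \<sigma> a)"
          using \<psi>' inst_in_words by metis
        then show ?thesis using \<sigma>(2) unfolding mono_line_def by metis
      qed
      then show ?thesis using P unfolding partite_def by blast
    qed
  qed
qed

section \<open>Graphs of large girth\<close>

text \<open>For a symmetric irreflexive relation this says that all cycles have length at least \<open>g\<close>:
  small vertex sets induce forests.\<close>

definition thin :: "nat \<Rightarrow> 'a set \<Rightarrow> ('a \<Rightarrow> 'a \<Rightarrow> bool) \<Rightarrow> bool" where
  "thin g V A \<longleftrightarrow> (\<forall>S\<subseteq>V. S \<noteq> {} \<longrightarrow> finite S \<longrightarrow> card S < g \<longrightarrow> (\<exists>v\<in>S. \<exists>p. \<forall>u\<in>S. A v u \<longrightarrow> u = p))"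

definition colourable :: "nat \<Rightarrow> 'a set \<Rightarrow> ('a \<Rightarrow> 'a \<Rightarrow> bool) \<Rightarrow> bool" where
  "colourable k V A \<longleftrightarrow> (\<exists>f :: 'a \<Rightarrow> nat. (\<forall>v\<in>V. f v < k) \<and> (\<forall>u\<in>V. \<forall>v\<in>V. A u v \<longrightarrow> f u \<noteq> f v))"

lemma thin_image:
  assumes "thin g V A" "inj_on f V" "\<And>u v. u \<in> V \<Longrightarrow> v \<in> V \<Longrightarrow> B (f u) (f v) \<longleftrightarrow> A u v"
  shows "thin g (f ` V) B"
  unfolding thin_def
proof (intro allI impI)
  fix S assume S: "S \<subseteq> f ` V" "S \<noteq> {}" "finite S" "card S < g"
  then obtain T where T: "T \<subseteq> V" "S = f ` T" by (meson subset_imageE)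
  have inj: "inj_on f T" using T(1) assms(2) inj_on_subset by blast
  then have "finite T" "card T < g" "T \<noteq> {}" using S T(2) by (auto simp: card_image finite_image_iff)
  then obtain v p where v: "v \<in> T" "\<And>u. u \<in> T \<Longrightarrow> A v u \<Longrightarrow> u = p"
    using assms(1) T(1) unfolding thin_def by metis
  have "y = f p" if "y \<in> S" "B (f v) y" for y
    using that v T assms(3) by (auto simp: subset_iff)
  then show "\<exists>v\<in>S. \<exists>p. \<forall>u\<in>S. B v u \<longrightarrow> u = p" using v(1) T(2) by blast
qed

lemma colourable_image:
  fixes f :: "'a \<Rightarrow> 'b"
  assumes "colourable k (f ` V) B" "\<And>u v. u \<in> V \<Longrightarrow> v \<in> V \<Longrightarrow> A u v \<Longrightarrow> B (f u) (f v)"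
  shows "colourable k V A"
proof -
  obtain c :: "'b \<Rightarrow> nat" where "\<forall>v\<in>f ` V. c v < k" "\<forall>u\<in>f ` V. \<forall>v\<in>f ` V. B u v \<longrightarrow> c u \<noteq> c v"
    using assms(1) unfolding colourable_def by blast
  then show ?thesis unfolding colourable_def
    by (intro exI[of _ "c \<circ> f"]) (simp add: assms(2))
qed

text \<open>A forest with a vertex besides \<open>x\<close> has a leaf besides \<open>x\<close>. If
  the leaf at hand is \<open>x\<close> itself, delete it and recurse with its possible neighbour
  \<open>p\<close> as the vertex to avoid: a leaf of the rest other than \<open>p\<close> is not
  adjacent to \<open>x\<close>.\<close>

lemma thin_second_leaf:
  assumes thin: "thin g V A" and irr: "\<And>v. \<not> A v v" and sym: "\<And>u v. A u v \<Longrightarrow> A v u"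
    and S: "finite S" "S \<subseteq> V" "card S < g" "S - {x} \<noteq> {}"
  shows "\<exists>v\<in>S - {x}. \<exists>p. \<forall>u\<in>S. A v u \<longrightarrow> u = p"
  using S
proof (induction S arbitrary: x rule: finite_psubset_induct)
  case (psubset S)
  obtain v p where v: "v \<in> S" "\<And>u. u \<in> S \<Longrightarrow> A v u \<Longrightarrow> u = p"
    using thin psubset.hyps psubset.prems unfolding thin_def by (metis Diff_empty Diff_eq_empty_iff empty_subsetI)
  show ?case
  proof (cases "v = x")
    case False
    then show ?thesis using v by blast
  next
    case True
    have sub: "S - {x} \<subset> S" using v(1) True by blast
    have crd: "card (S - {x}) < g"
      using psubset.prems(2) card_Diff1_le[of S x] by linarith
    show ?thesis
    proof (cases "S - {x} - {p} = {}")
      case False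
      have "\<exists>w\<in>S - {x} - {p}. \<exists>r. \<forall>u\<in>S - {x}. A w u \<longrightarrow> u = r"
        by (rule psubset.IH[OF sub]) (use psubset.prems(1) crd False in auto)
      then obtain w r where w: "w \<in> S - {x} - {p}" "\<forall>u\<in>S - {x}. A w u \<longrightarrow> u = r" by blast
      have "\<not> A w x"
      proof
        assume "A w x"
        from v(2)[OF _ sym[OF this, folded True]] w(1) show False by simp
      qed
      then have "\<forall>u\<in>S. A w u \<longrightarrow> u = r" using w(2) by auto
      then show ?thesis using w(1) by (intro bexI[of _ w] exI) auto
    next
      case True
      then have w: "S - {x} = {p}"
        using psubset.prems(3) by (metis Diff_eq_empty_iff subset_singletonD)
      have "u = x" if "u \<in> S" "A p u" for u
        using that irr w by (metis DiffI singletonD)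
      then show ?thesis using w by blast
    qed
  qed
qed

section \<open>Attaching copies of a graph to the lines of a hypergraph\<close>

text \<open>\<open>Inl\<close> carries the independent set of points; \<open>Inr (\<tau>, i)\<close>
  is vertex \<open>i\<close> of the copy that belongs to the line \<open>\<tau>\<close>. Each copy
  is joined to its line by a perfect matching.\<close>

fun attach :: "(nat \<Rightarrow> nat \<Rightarrow> bool) \<Rightarrow> nat list + nat option list \<times> nat \<Rightarrow> nat list + nat option list \<times> nat \<Rightarrow> bool" where
  "attach A (Inl w) (Inl w') = False"
| "attach A (Inl w) (Inr (\<tau>, i)) = (w = inst \<tau> i)"
| "attach A (Inr (\<tau>, i)) (Inl w) = (w = inst \<tau> i)"
| "attach A (Inr (\<tau>, i)) (Inr (\<tau>', i')) = (\<tau> = \<tau>' \<and> A i i')"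

definition attach_verts :: "nat \<Rightarrow> nat option list set \<Rightarrow> (nat list + nat option list \<times> nat) set" where
  "attach_verts N L = Inl ` \<Union>(pts N ` L) \<union> Inr ` (L \<times> {..<N})"

text \<open>In a small leafless \<open>S\<close> every point has neighbours in \<open>S\<close>
  under two different pairs \<open>(\<sigma>, j)\<close>. Among the lines occurring in
  \<open>S\<close> take a leaf \<open>\<tau>\<close>: only its point \<open>p\<close> can lead to
  other lines, so at most one vertex of the copy on \<open>\<tau>\<close> has its matching edge
  inside \<open>S\<close>. A leaf of that copy other than this vertex is then a leaf of
  \<open>S\<close>, a contradiction.\<close>

lemma thin_attach:
  assumes thin: "thin g {..<N} A" and irr: "\<And>i. \<not> A i i" and sym: "\<And>i j. A i j \<Longrightarrow> A j i"
    and L: "L \<subseteq> lines N n" and sp: "sparse (pts N) g L"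
  shows "thin g (attach_verts N L) (attach A)"
  unfolding thin_def
proof (intro allI impI, rule ccontr)
  fix S assume S: "S \<subseteq> attach_verts N L" "S \<noteq> {}" "finite S" "card S < g"
    and "\<not> (\<exists>v\<in>S. \<exists>p. \<forall>u\<in>S. attach A v u \<longrightarrow> u = p)"
  then have no_leaf: "\<exists>u\<in>S. attach A v u \<and> u \<noteq> p" if "v \<in> S" for v p using that by blast
  have SL: "\<tau> \<in> L" "i < N" if "Inr (\<tau>, i) \<in> S" for \<tau> i
    using that S(1) by (auto simp: attach_verts_def)
  have nb: "\<exists>\<sigma> j. Inr (\<sigma>, j) \<in> S \<and> w = inst \<sigma> j \<and> (\<sigma>, j) \<noteq> p" if w: "Inl w \<in> S" for w p
  proof -
    obtain u where u: "u \<in> S" "attach A (Inl w) u" "u \<noteq> Inr p" using no_leaf[OF w, of "Inr p"] by blast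
    then obtain \<sigma> j where "u = Inr (\<sigma>, j)" "w = inst \<sigma> j" by (cases u) auto
    then show ?thesis using u by blast
  qed
  define E where "E = {\<tau>. \<exists>i. Inr (\<tau>, i) \<in> S}"
  have "E \<subseteq> (\<lambda>s. fst (projr s)) ` S" by (force simp: E_def)
  then have E: "finite E" "card E < g"
    using S(3,4) surj_card_le[OF S(3)] finite_surj[OF S(3)] by fastforce+
  have EL: "E \<subseteq> L" using SL by (auto simp: E_def)
  have "E \<noteq> {}"
  proof -
    obtain s where s: "s \<in> S" using S(2) by blast
    show ?thesis
    proof (cases s)
      case (Inl w)
      then obtain \<sigma> j where "Inr (\<sigma>, j) \<in> S" using nb[of w undefined] s by blast
      then show ?thesis by (auto simp: E_def)
    next
      case (Inr b)
      then show ?thesis using s by (cases b) (auto simp: E_def)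
    qed
  qed
  have "\<exists>\<tau>. leaf (pts N) E \<tau>"
  proof (cases "2 \<le> card E")
    case True
    then show ?thesis using sp EL E(2) unfolding sparse_def by (metis less_imp_le)
  next
    case False
    moreover have "card E \<noteq> 0" using E(1) \<open>E \<noteq> {}\<close> by simp
    ultimately have "card E = 1" by linarith
    then obtain \<tau> where "E = {\<tau>}" by (auto simp: card_1_singleton_iff)
    then show ?thesis by (auto simp: leaf_def)
  qed
  then obtain \<tau> p where \<tau>E: "\<tau> \<in> E" and \<tau>: "\<And>\<sigma>. \<sigma> \<in> E \<Longrightarrow> \<sigma> \<noteq> \<tau> \<Longrightarrow> pts N \<tau> \<inter> pts N \<sigma> \<subseteq> {p}"
    unfolding leaf_def by blast
  have inj: "i = j" if "inst \<tau> i = inst \<tau> j" for i j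
    using inst_inj[OF _ that] \<tau>E EL L by (auto simp: lines_def)
  have exit: "inst \<tau> i = p" if iS: "Inr (\<tau>, i) \<in> S" "Inl (inst \<tau> i) \<in> S" for i
  proof -
    obtain \<sigma> j where \<sigma>: "Inr (\<sigma>, j) \<in> S" "inst \<tau> i = inst \<sigma> j" "(\<sigma>, j) \<noteq> (\<tau>, i)"
      using nb[OF iS(2)] by blast
    then have "\<sigma> \<noteq> \<tau>" using inj by blast
    moreover have "\<sigma> \<in> E" using \<sigma> by (auto simp: E_def)
    moreover have "inst \<tau> i \<in> pts N \<tau> \<inter> pts N \<sigma>"
      using SL[OF iS(1)] SL[OF \<sigma>(1)] \<sigma>(2) unfolding pts_def by (metis IntI imageI lessThan_iff)
    ultimately show ?thesis using \<tau> by blast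
  qed
  define T where "T = {i. Inr (\<tau>, i) \<in> S}"
  have TN: "T \<subseteq> {..<N}" using SL by (auto simp: T_def)
  then have finT: "finite T" using finite_subset by blast
  have "T \<noteq> {}" using \<tau>E by (auto simp: T_def E_def)
  have "card T \<le> card S"
    by (rule card_inj_on_le[of "\<lambda>i. Inr (\<tau>, i)"]) (use S(3) in \<open>auto simp: inj_on_def T_def\<close>)
  then have cardT: "card T < g" using S(4) by linarith
  \<comment> \<open>The vertex to avoid: the one matched to the exit point \<open>p\<close> if it
    occurs in \<open>S\<close>, otherwise an arbitrary one.\<close>
  define i0 where "i0 = (if \<exists>i\<in>T. inst \<tau> i = p then SOME i. i \<in> T \<and> inst \<tau> i = p else SOME i. i \<in> T)"
  have i0: "i0 \<in> T \<and> ((\<exists>i\<in>T. inst \<tau> i = p) \<longrightarrow> inst \<tau> i0 = p)"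
  proof (cases "\<exists>i\<in>T. inst \<tau> i = p")
    case True
    then have "i0 \<in> T \<and> inst \<tau> i0 = p"
      using someI_ex[of "\<lambda>i. i \<in> T \<and> inst \<tau> i = p"] by (auto simp: i0_def)
    then show ?thesis by blast
  next
    case False
    then show ?thesis using some_in_eq[of T] \<open>T \<noteq> {}\<close> by (simp add: i0_def)
  qed
  show False
  proof (cases "T - {i0} = {}")
    case True
    have "Inr (\<tau>, i0) \<in> S" using i0 by (simp add: T_def)
    from no_leaf[OF this, of "Inl (inst \<tau> i0)"]
    obtain u where u: "u \<in> S" "attach A (Inr (\<tau>, i0)) u" "u \<noteq> Inl (inst \<tau> i0)" by blast
    then obtain j where "u = Inr (\<tau>, j)" "A i0 j" by (cases u) auto
    moreover have "j = i0" using True u(1) \<open>u = Inr (\<tau>, j)\<close> by (auto simp: T_def)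
    ultimately show False using irr by blast
  next
    case False
    obtain i q where i: "i \<in> T" "i \<noteq> i0" "\<And>j. j \<in> T \<Longrightarrow> A i j \<Longrightarrow> j = q"
      using thin_second_leaf[OF thin irr sym finT TN cardT False] by blast
    have iS: "Inr (\<tau>, i) \<in> S" using i(1) by (simp add: T_def)
    from no_leaf[OF this, of "Inr (\<tau>, q)"]
    obtain u where u: "u \<in> S" "attach A (Inr (\<tau>, i)) u" "u \<noteq> Inr (\<tau>, q)" by blast
    show False
    proof (cases u)
      case (Inl w)
      then have "Inl (inst \<tau> i) \<in> S" using u by simp
      then have "inst \<tau> i = p" using exit iS by blast
      then have "inst \<tau> i0 = inst \<tau> i" using i0 i(1) by auto
      then show False using inj i(2) by blast
    next
      case (Inr b)
      then show False using u i(3) by (cases b) (auto simp: T_def)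
    qed
  qed
qed

text \<open>A line of constant colour bars that colour from the copy attached to it.\<close>

lemma not_colourable_attach:
  assumes nc: "\<not> colourable k {..<N} A"
    and L: "\<And>c :: nat list \<Rightarrow> nat. (\<forall>x. c x < Suc k) \<Longrightarrow> \<exists>\<tau>\<in>L. mono_line N c \<tau>"
  shows "\<not> colourable (Suc k) (attach_verts N L) (attach A)"
proof
  assume "colourable (Suc k) (attach_verts N L) (attach A)"
  then obtain f :: "nat list + nat option list \<times> nat \<Rightarrow> nat" where
    f: "\<And>v. v \<in> attach_verts N L \<Longrightarrow> f v < Suc k"
    "\<And>u v. u \<in> attach_verts N L \<Longrightarrow> v \<in> attach_verts N L \<Longrightarrow> attach A u v \<Longrightarrow> f u \<noteq> f v"
    unfolding colourable_def by blast
  \<comment> \<open>Words on no line get the colour 0 because the bound on colours is required for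
    all words.\<close>
  define c where "c w = (if Inl w \<in> attach_verts N L then f (Inl w) else 0)" for w
  have "\<forall>x. c x < Suc k" using f(1) by (simp add: c_def)
  then obtain \<tau> where \<tau>: "\<tau> \<in> L" "mono_line N c \<tau>" using L by blast
  define \<kappa> where "\<kappa> = c (inst \<tau> 0)"
  have Inr_v: "Inr (\<tau>, i) \<in> attach_verts N L" if "i < N" for i
    using that \<tau>(1) by (simp add: attach_verts_def)
  have Inl_v: "Inl (inst \<tau> i) \<in> attach_verts N L" if "i < N" for i
    using that \<tau>(1) by (auto simp: attach_verts_def pts_def)
  have avoid: "f (Inr (\<tau>, i)) \<noteq> \<kappa>" if "i < N" for i
  proof -
    have "f (Inl (inst \<tau> i)) = c (inst \<tau> i)" using Inl_v[OF that] by (simp add: c_def)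
    also have "\<dots> = \<kappa>" using \<tau>(2) that unfolding mono_line_def \<kappa>_def by (meson bot_nat_0.not_eq_extremum not_less0 order_le_less_trans zero_le)
    finally show ?thesis using f(2)[OF Inr_v[OF that] Inl_v[OF that]] by simp
  qed
  \<comment> \<open>As \<open>\<kappa>\<close> is free on this copy, the top colour \<open>k\<close>
    can be renamed to \<open>\<kappa>\<close>, which leaves a colouring with \<open>k\<close>
    colours.\<close>
  define h where "h i = (let x = f (Inr (\<tau>, i)) in if x = k then \<kappa> else x)" for i
  have "h i < k" if "i < N" for i
  proof -
    have "\<kappa> \<le> k" using \<open>\<forall>x. c x < Suc k\<close> by (auto simp: \<kappa>_def less_Suc_eq_le)
    then show ?thesis using avoid[OF that] f(1)[OF Inr_v[OF that]] by (auto simp: h_def Let_def)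
  qed
  moreover have "h i \<noteq> h j" if "i < N" "j < N" "A i j" for i j
    using f(2)[OF Inr_v[OF that(1)] Inr_v[OF that(2)]] avoid[OF that(1)] avoid[OF that(2)] that(3)
    by (auto simp: h_def Let_def)
  ultimately show False using nc unfolding colourable_def by blast
qed

lemma finite_attach_verts: "finite L \<Longrightarrow> finite (attach_verts N L)"
  by (simp add: attach_verts_def pts_def)

section \<open>Generic complex weights\<close>

text \<open>An open dense set in the product topology. Openness makes finite intersections dense
  again.\<close>

definition generic :: "((nat \<Rightarrow> complex) \<Rightarrow> bool) \<Rightarrow> bool" where
  "generic P \<longleftrightarrow> open {x. P x} \<and> (\<forall>U. open U \<longrightarrow> U \<noteq> {} \<longrightarrow> (\<exists>x\<in>U. P x))"

lemma generic_conj: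
  assumes "generic P" "generic Q" shows "generic (\<lambda>x. P x \<and> Q x)"
  unfolding generic_def
proof (intro conjI allI impI)
  have op: "open {x. P x}" "open {x. Q x}" using assms by (auto simp: generic_def)
  show "open {x. P x \<and> Q x}" using op by (rule open_Collect_conj)
  fix U :: "(nat \<Rightarrow> complex) set" assume U: "open U" "U \<noteq> {}"
  then have "U \<inter> {x. P x} \<noteq> {}" using assms(1) by (auto simp: generic_def)
  then have "\<exists>x\<in>U \<inter> {x. P x}. Q x"
    using assms(2) open_Int[OF U(1) op(1)] unfolding generic_def by blast
  then show "\<exists>x\<in>U. P x \<and> Q x" by blast
qed

lemma generic_Ball:
  assumes "finite A" "\<And>a. a \<in> A \<Longrightarrow> generic (P a)"
  shows "generic (\<lambda>x. \<forall>a\<in>A. P a x)"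
  using assms
proof (induction A)
  case empty
  then show ?case by (auto simp: generic_def)
next
  case (insert a A)
  then show ?case using generic_conj[of "P a" "\<lambda>x. \<forall>a\<in>A. P a x"] by simp
qed

text \<open>Density is tested on a single curve through each point of a set already known to be
  dense: the curve spends infinitely many parameters in \<open>U\<close> but violates
  \<open>P\<close> only finitely often.\<close>

lemma generic_along_curves:
  assumes Q: "generic Q" and op: "open {x. P x}"
    and curve: "\<And>x. Q x \<Longrightarrow> \<exists>\<gamma> :: real \<Rightarrow> nat \<Rightarrow> complex. continuous_on UNIV \<gamma> \<and> \<gamma> 0 = x \<and> finite {t. \<not> P (\<gamma> t)}"
  shows "generic P"
  unfolding generic_def
proof (intro conjI allI impI op)
  fix U :: "(nat \<Rightarrow> complex) set" assume U: "open U" "U \<noteq> {}"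
  then obtain x where x: "x \<in> U" "Q x" using Q unfolding generic_def by blast
  obtain \<gamma> :: "real \<Rightarrow> nat \<Rightarrow> complex" where \<gamma>: "continuous_on UNIV \<gamma>" "\<gamma> 0 = x" "finite {t. \<not> P (\<gamma> t)}"
    using curve[OF x(2)] by blast
  have "open (\<gamma> -` U)" using continuous_on_open_vimage[OF open_UNIV, of \<gamma>] \<gamma>(1) U(1) by simp
  moreover have "\<gamma> -` U \<noteq> {}" using \<gamma>(2) x(1) by blast
  ultimately have "infinite (\<gamma> -` U)" using finite_imp_not_open by blast
  then have "\<not> \<gamma> -` U \<subseteq> {t. \<not> P (\<gamma> t)}" using \<gamma>(3) finite_subset by blast
  then show "\<exists>y\<in>U. P y" by blast
qed

definition lin :: "nat \<Rightarrow> (nat \<Rightarrow> complex) \<Rightarrow> (nat \<Rightarrow> complex) \<Rightarrow> complex" where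
  "lin n a x = (\<Sum>j<n. a j * x j)"

lemma continuous_lin [continuous_intros]: "continuous_on S (lin n a)"
  unfolding lin_def
  by (intro continuous_intros continuous_on_subset[OF continuous_on_product_coordinates]) auto

definition shift :: "(nat \<Rightarrow> complex) \<Rightarrow> nat \<Rightarrow> complex \<Rightarrow> real \<Rightarrow> nat \<Rightarrow> complex" where
  "shift x j u t = x(j := x j + of_real t * u)"

lemma continuous_shift: "continuous_on S (shift x j u)"
proof (rule continuous_on_coordinatewise_then_product)
  fix i show "continuous_on S (\<lambda>t. shift x j u t i)"
    by (cases "i = j") (auto simp: shift_def intro!: continuous_intros)
qed

lemma lin_shift:
  assumes "j < n"
  shows "lin n a (shift x j u t) = lin n a x + of_real t * (a j * u)"
proof -
  have "lin n a (shift x j u t) = (\<Sum>i<n. a i * x i + (if i = j then of_real t * (a j * u) else 0))"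
    unfolding lin_def by (rule sum.cong) (auto simp: shift_def algebra_simps)
  also have "\<dots> = lin n a x + of_real t * (a j * u)"
    using assms by (simp add: sum.distrib lin_def)
  finally show ?thesis .
qed

lemma norm_line_sq: "(cmod (A + of_real t * c))\<^sup>2 = (cmod c)\<^sup>2 * t\<^sup>2 + 2 * Re (A * cnj c) * t + (cmod A)\<^sup>2"
  unfolding cmod_power2 by (simp add: power2_eq_square algebra_simps)

lemma finite_quadratic_roots:
  fixes a b c :: real
  assumes "a \<noteq> 0" shows "finite {t. a * t\<^sup>2 + b * t + c = 0}"
proof -
  have "finite {t. poly [:c, b, a:] t = 0}" by (rule poly_roots_finite) (use assms in simp)
  moreover have "poly [:c, b, a:] t = a * t\<^sup>2 + b * t + c" for t
    by (simp add: power2_eq_square algebra_simps)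
  ultimately show ?thesis by (simp only:)
qed

text \<open>When only \<open>x j\<close> moves along a real line, the difference of the squared
  norms is a quadratic in \<open>t\<close> with leading coefficient
  \<open>(cmod (a j))\<^sup>2 - (cmod (b j))\<^sup>2\<close>.\<close>

lemma generic_norm_lin_neq:
  assumes "j < n" "cmod (a j) \<noteq> cmod (b j)"
  shows "generic (\<lambda>x. cmod (lin n a x) \<noteq> cmod (lin n b x))"
proof (rule generic_along_curves[where Q = "\<lambda>_. True"])
  show "generic (\<lambda>_. True)" by (auto simp: generic_def)
  show "open {x. cmod (lin n a x) \<noteq> cmod (lin n b x)}"
    by (intro open_Collect_neq continuous_intros)
  fix x :: "nat \<Rightarrow> complex"
  let ?A = "lin n a x" and ?B = "lin n b x"
  have ne: "(cmod (a j))\<^sup>2 - (cmod (b j))\<^sup>2 \<noteq> 0"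
    using assms(2) by simp
  have "(cmod (?A + of_real t * a j) = cmod (?B + of_real t * b j)) \<longleftrightarrow>
      ((cmod (a j))\<^sup>2 - (cmod (b j))\<^sup>2) * t\<^sup>2 + (2 * Re (?A * cnj (a j)) - 2 * Re (?B * cnj (b j))) * t
        + ((cmod ?A)\<^sup>2 - (cmod ?B)\<^sup>2) = 0" (is "?l t = ?r t") for t
  proof -
    have "?l t \<longleftrightarrow> (cmod (?A + of_real t * a j))\<^sup>2 - (cmod (?B + of_real t * b j))\<^sup>2 = 0" by simp
    then show ?thesis unfolding norm_line_sq by (simp add: algebra_simps)
  qed
  then have "finite {t. cmod (lin n a (shift x j 1 t)) = cmod (lin n b (shift x j 1 t))}"
    using finite_quadratic_roots[OF ne] by (simp add: lin_shift[OF assms(1)])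
  then show "\<exists>\<gamma>. continuous_on UNIV \<gamma> \<and> \<gamma> (0::real) = x \<and>
      finite {t. \<not> cmod (lin n a (\<gamma> t)) \<noteq> cmod (lin n b (\<gamma> t))}"
    by (intro exI[of _ "shift x j 1"]) (simp add: continuous_shift, simp add: shift_def)
qed

text \<open>Squaring away the root gives a polynomial equation of degree four, and it is not trivial
  because \<open>K * (1 + t\<^sup>2)\<close> is not the square of a real polynomial.\<close>

lemma finite_solutions_with_root:
  fixes \<alpha> \<beta> \<gamma> r h :: real
  assumes "r > 0" "h > 0"
  shows "finite {t. \<alpha> * t\<^sup>2 + \<beta> * t + \<gamma> = (r * sqrt (1 + t\<^sup>2) - h)\<^sup>2}"
proof -
  define K a c where "K = (2 * r * h)\<^sup>2" and "a = \<alpha> - r\<^sup>2" and "c = \<gamma> - r\<^sup>2 - h\<^sup>2"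
  define p where "p = [:c\<^sup>2 - K, 2 * \<beta> * c, \<beta>\<^sup>2 + 2 * a * c - K, 2 * a * \<beta>, a\<^sup>2:]"
  have "K > 0" using assms by (simp add: K_def)
  have "p \<noteq> 0"
  proof
    assume "p = 0"
    then have "a = 0" "\<beta>\<^sup>2 + 2 * a * c = K" "\<beta> * c = 0" "c\<^sup>2 = K" by (auto simp: p_def)
    then show False using \<open>K > 0\<close> by auto
  qed
  then have fin: "finite {t. poly p t = 0}" by (rule poly_roots_finite)
  have sub: "poly p t = 0" if t: "\<alpha> * t\<^sup>2 + \<beta> * t + \<gamma> = (r * sqrt (1 + t\<^sup>2) - h)\<^sup>2" for t
  proof -
    have s: "(sqrt (1 + t\<^sup>2))\<^sup>2 = 1 + t\<^sup>2" by (simp add: add_nonneg_nonneg)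
    have "a * t\<^sup>2 + \<beta> * t + c = - (2 * r * h) * sqrt (1 + t\<^sup>2)"
      using t s unfolding a_def c_def power2_diff power_mult_distrib by (simp add: algebra_simps)
    then have "(a * t\<^sup>2 + \<beta> * t + c)\<^sup>2 = K * (1 + t\<^sup>2)"
      using s by (simp add: power_mult_distrib K_def)
    then show ?thesis by (simp add: p_def power2_eq_square algebra_simps)
  qed
  show ?thesis by (rule finite_subset[OF _ fin]) (use sub in blast)
qed

text \<open>Covers two copies with different scale factors \<open>lin n b x\<close> and
  \<open>lin n b' x\<close>. Varying a coordinate that occurs only in the first leaves one square
  root in the equation, which \<open>finite_solutions_with_root\<close> can treat.\<close>

lemma generic_tangency_aux:
  assumes j: "j < n" "b j = 1" "b' j = 0" and pos: "\<rho> > 0" "\<rho>' > 0"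
    and ne: "generic (\<lambda>x. lin n b x \<noteq> 0 \<and> lin n b' x \<noteq> 0)"
  shows "generic (\<lambda>x. (cmod (lin n a x))\<^sup>2 \<noteq> (\<rho> * cmod (lin n b x) - \<rho>' * cmod (lin n b' x))\<^sup>2)"
proof (rule generic_along_curves[OF ne])
  show "open {x. (cmod (lin n a x))\<^sup>2 \<noteq> (\<rho> * cmod (lin n b x) - \<rho>' * cmod (lin n b' x))\<^sup>2}"
    by (intro open_Collect_neq continuous_intros)
  fix x assume x: "lin n b x \<noteq> 0 \<and> lin n b' x \<noteq> 0"
  \<comment> \<open>Moving perpendicularly to \<open>lin n b x\<close> turns its norm into a
    multiple of \<open>sqrt (1 + t\<^sup>2)\<close>, without a linear term under the root.\<close>
  define u where "u = \<i> * lin n b x"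
  let ?s = "shift x j u"
  have A: "(cmod (lin n a (?s t)))\<^sup>2 = (cmod (a j * u))\<^sup>2 * t\<^sup>2 + 2 * Re (lin n a x * cnj (a j * u)) * t
      + (cmod (lin n a x))\<^sup>2" for t
    unfolding lin_shift[OF j(1)] by (rule norm_line_sq)
  have B: "cmod (lin n b (?s t)) = cmod (lin n b x) * sqrt (1 + t\<^sup>2)" for t
  proof -
    have "lin n b (?s t) = lin n b x * Complex 1 t"
      unfolding lin_shift[OF j(1)] j(2) u_def by (simp add: complex_eq_iff)
    then show ?thesis by (simp add: norm_mult complex_norm)
  qed
  have B': "lin n b' (?s t) = lin n b' x" for t
    unfolding lin_shift[OF j(1)] j(3) by simp
  have "finite {t. (cmod (lin n a (?s t)))\<^sup>2 = (\<rho> * cmod (lin n b (?s t)) - \<rho>' * cmod (lin n b' (?s t)))\<^sup>2}"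
    unfolding A B B' mult.assoc[symmetric]
    by (rule finite_solutions_with_root) (use x pos in auto)
  then show "\<exists>\<gamma>. continuous_on UNIV \<gamma> \<and> \<gamma> (0::real) = x \<and>
      finite {t. \<not> (cmod (lin n a (\<gamma> t)))\<^sup>2 \<noteq> (\<rho> * cmod (lin n b (\<gamma> t)) - \<rho>' * cmod (lin n b' (\<gamma> t)))\<^sup>2}"
    by (intro exI[of _ ?s]) (simp add: continuous_shift, simp add: shift_def)
qed

lemma generic_lin_indicator_nonzero:
  assumes "J \<subseteq> {..<n}" "J \<noteq> {}"
  shows "generic (\<lambda>x. lin n (indicator J) x \<noteq> 0)"
proof -
  obtain j where "j \<in> J" using assms by blast
  then have "generic (\<lambda>x. cmod (lin n (indicator J) x) \<noteq> cmod (lin n (\<lambda>_. 0) x))"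
    using assms by (intro generic_norm_lin_neq[of j]) auto
  then show ?thesis by (simp add: lin_def)
qed

lemma generic_tangency:
  assumes J: "J \<subseteq> {..<n}" "J \<noteq> {}" and J': "J' \<subseteq> {..<n}" "J' \<noteq> {}" and "J \<noteq> J'"
    and pos: "\<rho> > 0" "\<rho>' > 0"
  shows "generic (\<lambda>x. (cmod (lin n a x))\<^sup>2 \<noteq>
    (\<rho> * cmod (lin n (indicator J) x) - \<rho>' * cmod (lin n (indicator J') x))\<^sup>2)"
proof -
  note nz = generic_lin_indicator_nonzero[OF J] generic_lin_indicator_nonzero[OF J']
  consider j where "j \<in> J" "j \<notin> J'" | j where "j \<in> J'" "j \<notin> J" using \<open>J \<noteq> J'\<close> by blast
  then show ?thesis
  proof cases
    case 1
    then show ?thesis using J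
      by (intro generic_tangency_aux[of j] generic_conj nz pos) auto
  next
    case 2
    then have "generic (\<lambda>x. (cmod (lin n a x))\<^sup>2 \<noteq>
      (\<rho>' * cmod (lin n (indicator J') x) - \<rho> * cmod (lin n (indicator J) x))\<^sup>2)"
      using J' by (intro generic_tangency_aux[of j] generic_conj nz pos) auto
    then show ?thesis by (simp only: power2_commute[of "\<rho> * _"])
  qed
qed

section \<open>Intersections of circles and private points\<close>

lemma infinite_circle:
  fixes q :: complex assumes "\<rho> > 0" shows "infinite (sphere q \<rho>)"
proof
  assume fin: "finite (sphere q \<rho>)"
  have "{-\<rho>..\<rho>} \<subseteq> (\<lambda>z. Re (z - q)) ` sphere q \<rho>"
  proof
    fix s assume s: "s \<in> {-\<rho>..\<rho>}"
    then have "\<rho>\<^sup>2 - s\<^sup>2 \<ge> 0" by (simp add: abs_le_square_iff[symmetric] abs_le_iff)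
    then have "q + Complex s (sqrt (\<rho>\<^sup>2 - s\<^sup>2)) \<in> sphere q \<rho>"
      using assms by (simp add: dist_norm complex_norm)
    then show "s \<in> (\<lambda>z. Re (z - q)) ` sphere q \<rho>" by (rule rev_image_eqI) simp
  qed
  then have "finite {-\<rho>..\<rho>}" using fin finite_surj by blast
  then show False using assms by (simp add: infinite_Icc)
qed

text \<open>Multiplication by \<open>cnj d\<close> turns the line of centres into the real axis. By
  the law of cosines the real part of \<open>w\<close> is then \<open>\<kappa>\<close>, and its
  imaginary part solves a quadratic.\<close>

lemma finite_circle_Int:
  fixes q q' :: complex
  assumes "(q, \<rho>) \<noteq> (q', \<rho>')"
  shows "finite (sphere q \<rho> \<inter> sphere q' \<rho>')"
proof (cases "q = q'")
  case True
  then have "sphere q \<rho> \<inter> sphere q' \<rho>' = {}" using assms by auto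
  then show ?thesis by simp
next
  case False
  define d where "d = q' - q"
  have d: "d \<noteq> 0" using False by (simp add: d_def)
  define \<kappa> where "\<kappa> = (\<rho>\<^sup>2 + (cmod d)\<^sup>2 - \<rho>'\<^sup>2) / 2"
  define f where "f y = q + Complex \<kappa> y / cnj d" for y
  have "sphere q \<rho> \<inter> sphere q' \<rho>' \<subseteq> f ` {y. 1 * y\<^sup>2 + 0 * y + (\<kappa>\<^sup>2 - (\<rho> * cmod d)\<^sup>2) = 0}"
  proof
    fix z assume "z \<in> sphere q \<rho> \<inter> sphere q' \<rho>'"
    then have z: "cmod (z - q) = \<rho>" "cmod (z - q - d) = \<rho>'"
      by (auto simp: dist_norm norm_minus_commute d_def)
    define w where "w = (z - q) * cnj d"
    have "\<rho>'\<^sup>2 = \<rho>\<^sup>2 - 2 * Re w + (cmod d)\<^sup>2"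
      unfolding z[symmetric] cmod_power2 w_def by (simp add: power2_eq_square algebra_simps)
    then have re: "Re w = \<kappa>" by (simp add: \<kappa>_def)
    have "cmod w = \<rho> * cmod d" using z by (simp add: w_def norm_mult)
    then have "\<kappa>\<^sup>2 + (Im w)\<^sup>2 = (\<rho> * cmod d)\<^sup>2" using re cmod_power2[of w] by simp
    moreover have "z = f (Im w)"
    proof -
      have "Complex \<kappa> (Im w) = w" using re by (simp add: complex_eq_iff)
      then show ?thesis using d by (simp add: f_def w_def)
    qed
    ultimately show "z \<in> f ` {y. 1 * y\<^sup>2 + 0 * y + (\<kappa>\<^sup>2 - (\<rho> * cmod d)\<^sup>2) = 0}" by auto
  qed
  then show ?thesis
    by (rule finite_subset) (intro finite_imageI finite_quadratic_roots, simp)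
qed

lemma exists_private_point:
  fixes C :: "(complex \<times> real) set"
  assumes "finite C" "(q, \<rho>) \<in> C" "\<rho> > 0"
  shows "\<exists>z. cmod (z - q) = \<rho> \<and> (\<forall>c\<in>C - {(q, \<rho>)}. cmod (z - fst c) \<noteq> snd c)"
proof -
  let ?B = "\<Union>c \<in> C - {(q, \<rho>)}. sphere q \<rho> \<inter> sphere (fst c) (snd c)"
  have "finite (sphere q \<rho> \<inter> sphere (fst c) (snd c))" if "c \<in> C - {(q, \<rho>)}" for c
    by (rule finite_circle_Int) (use that in auto)
  then have "finite ?B" using assms(1) by (intro finite_UN_I) auto
  then have "\<not> sphere q \<rho> \<subseteq> ?B" using infinite_circle[OF assms(3)] finite_subset by blast
  then obtain z where z: "z \<in> sphere q \<rho>" "z \<notin> ?B" by blast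
  have mem: "z \<in> sphere q' \<rho>' \<longleftrightarrow> cmod (z - q') = \<rho>'" for q' \<rho>'
    by (simp add: dist_norm norm_minus_commute[of q' z])
  show ?thesis
  proof (intro exI[of _ z] conjI ballI)
    show "cmod (z - q) = \<rho>" using z(1) mem by blast
    fix c assume "c \<in> C - {(q, \<rho>)}"
    then have "z \<notin> sphere (fst c) (snd c)" using z by blast
    then show "cmod (z - fst c) \<noteq> snd c" using mem by blast
  qed
qed

section \<open>Circles in the plane\<close>

definition emb :: "complex \<Rightarrow> plane" where
  "emb z = vector [Re z, Im z]"

lemma dist_emb: "dist (emb z) (emb w) = dist z w"
  by (simp add: emb_def dist_vec_def L2_set_def sum_2 dist_norm cmod_power2[symmetric] cmod_def)

lemma emb_inj: "emb z = emb w \<longleftrightarrow> z = w"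
  by (metis dist_emb dist_eq_0_iff)

lemma surj_emb: "surj emb"
proof (rule surjI)
  fix x :: plane show "emb (Complex (x $ 1) (x $ 2)) = x"
    by (simp add: emb_def vec_eq_iff forall_2)
qed

lemma sphere_emb: "sphere (emb q) r = emb ` sphere q r"
proof -
  have "x \<in> sphere (emb q) r \<longleftrightarrow> x \<in> emb ` sphere q r" for x
  proof -
    obtain z where "x = emb z" using surj_emb by blast
    then show ?thesis by (auto simp: dist_emb emb_inj)
  qed
  then show ?thesis by blast
qed

text \<open>The point of contact lies on the ray from \<open>q\<close> through \<open>q'\<close>,
  beyond \<open>q'\<close>. It is unique because for any common point the triangle inequality with
  \<open>q\<close> and \<open>q'\<close> is an equality.\<close>

lemma circles_touch_internally:
  fixes q q' :: complex
  assumes "cmod (q - q') = r - r'" "r' > 0" "q \<noteq> q'"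
  shows "\<exists>p. sphere q r \<inter> sphere q' r' = {p}"
proof -
  define D where "D = r - r'"
  have "cmod (q - q') > 0" using assms(3) by simp
  then have D: "D > 0" "cmod (q' - q) = D" using assms(1) by (auto simp: D_def norm_minus_commute)
  define p where "p = q' + of_real (r' / D) * (q' - q)"
  have p': "p - q' = of_real (r' / D) * (q' - q)" by (simp add: p_def)
  have "1 + r' / D = r / D" using D(1) by (simp add: D_def field_simps)
  then have "p - q = of_real (r / D) * (q' - q)"
    by (simp add: p_def algebra_simps flip: \<open>1 + r' / D = r / D\<close>)
  then have "cmod (p - q) = \<bar>r / D\<bar> * D" by (simp only: norm_mult norm_of_real D(2))
  then have "cmod (p - q) = r" using D(1) assms(2) by (simp add: D_def)
  moreover have "cmod (p - q') = r'"
    unfolding p' norm_mult norm_of_real D(2) using D(1) assms(2) by simp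
  moreover have "z = p" if z: "cmod (z - q) = r" "cmod (z - q') = r'" for z
  proof -
    have "norm ((z - q') + (q' - q)) = norm (z - q') + norm (q' - q)"
      using z D by (simp add: D_def)
    then have "cmod (z - q') *\<^sub>R (q' - q) = cmod (q' - q) *\<^sub>R (z - q')"
      by (rule norm_triangle_eq[THEN iffD1])
    then have "r' *\<^sub>R (q' - q) = D *\<^sub>R (z - q')" unfolding z D(2) .
    then have "z - q' = of_real (r' / D) * (q' - q)"
      using D(1) by (simp add: scaleR_conv_of_real field_simps)
    then have "z - q' = p - q'" by (simp only: p')
    then show ?thesis by simp
  qed
  ultimately have "sphere q r \<inter> sphere q' r' = {p}"
    by (auto simp: dist_norm norm_minus_commute)
  then show ?thesis ..
qed

text \<open>The reflection in the line of centres fixes the only common point, which is therefore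
  collinear with the centres.\<close>

lemma single_common_point:
  fixes q q' :: complex
  assumes p: "sphere q r \<inter> sphere q' r' = {p}" and ne: "q \<noteq> q'" and lt: "cmod (q - q') < r + r'"
  shows "cmod (q - q') = \<bar>r - r'\<bar>"
proof -
  define d w where "d = q' - q" and "w = (p - q) / d"
  have d: "d \<noteq> 0" using ne by (simp add: d_def)
  have "p - q = d * w" using d by (simp add: w_def)
  then have dw: "p = q + d * w" by (simp add: algebra_simps)
  have "p \<in> sphere q r" "p \<in> sphere q' r'" using p by auto
  then have r: "r = cmod d * cmod w" "r' = cmod d * cmod (w - 1)"
  proof -
    have "p - q' = d * (w - 1)" unfolding dw by (simp add: d_def algebra_simps)
    then show "r' = cmod d * cmod (w - 1)"
      using \<open>p \<in> sphere q' r'\<close> by (simp add: dist_norm norm_minus_commute norm_mult)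
    show "r = cmod d * cmod w"
      using \<open>p \<in> sphere q r\<close> dw by (simp add: dist_norm norm_mult)
  qed
  define p' where "p' = q + d * cnj w"
  have "cmod (p' - q) = r" by (simp add: p'_def norm_mult r)
  moreover have "cmod (p' - q') = r'"
  proof -
    have "p' - q' = d * cnj (w - 1)" unfolding p'_def by (simp add: d_def algebra_simps)
    then have "cmod (p' - q') = cmod d * cmod (cnj (w - 1))" by (simp only: norm_mult)
    then show ?thesis unfolding complex_mod_cnj r(2) .
  qed
  ultimately have "p' \<in> sphere q r \<inter> sphere q' r'"
    by (simp add: dist_norm norm_minus_commute[of q p'] norm_minus_commute[of q' p'])
  then have "p' = p" using p by blast
  then have "cnj w = w" using d by (simp add: p'_def dw)
  then have "w \<in> \<real>" by (simp add: Reals_cnj_iff)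
  then obtain s where s: "w = of_real s" by (auto elim: Reals_cases)
  have ws: "cmod w = \<bar>s\<bar>" "cmod (w - 1) = \<bar>s - 1\<bar>"
    using s norm_of_real[of "s - 1", where 'a = complex] by auto
  have dd: "cmod (q - q') = cmod d" by (simp add: d_def norm_minus_commute)
  \<comment> \<open>The bound on the distance of the centres puts \<open>s\<close> outside the
    interval from 0 to 1, so the common point is not between the centres: external tangency is
    excluded here.\<close>
  have "cmod d * 1 < cmod d * (\<bar>s\<bar> + \<bar>s - 1\<bar>)"
    using lt unfolding dd r ws by (simp add: algebra_simps)
  then have "1 < \<bar>s\<bar> + \<bar>s - 1\<bar>" using d by (simp add: mult_less_cancel_left_pos)
  then have "\<bar>\<bar>s\<bar> - \<bar>s - 1\<bar>\<bar> = 1" by linarith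
  moreover have "r - r' = cmod d * (\<bar>s\<bar> - \<bar>s - 1\<bar>)" unfolding r ws by (simp add: algebra_simps)
  ultimately show ?thesis unfolding dd by (simp add: abs_mult)
qed

lemma single_common_point_iff:
  fixes q q' :: complex
  assumes "(q, r) \<noteq> (q', r')" "r > 0" "r' > 0" "cmod (q - q') < r + r'"
  shows "(\<exists>p. sphere q r \<inter> sphere q' r' = {p}) \<longleftrightarrow> cmod (q - q') = \<bar>r - r'\<bar>"
proof (cases "q = q'")
  case True
  then have "sphere q r \<inter> sphere q' r' = {}" "r \<noteq> r'" using assms(1) by auto
  then show ?thesis using True by auto
next
  case False
  have "\<exists>p. sphere q r \<inter> sphere q' r' = {p}" if "cmod (q - q') = \<bar>r - r'\<bar>"
  proof (cases "r \<ge> r'")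
    case True
    then show ?thesis using circles_touch_internally[of q q' r r'] that assms False by simp
  next
    case 2: False
    then show ?thesis
      using circles_touch_internally[of q' q r' r] that assms False
      by (simp add: norm_minus_commute Int_commute)
  qed
  then show ?thesis using single_common_point[OF _ False assms(4)] by blast
qed

text \<open>Lightlike separation in the Minkowski space of pairs \<open>(q, r)\<close>, hence
  invariant under adding a constant to all radii. The equation holds trivially for
  \<open>x = y\<close>, which has to be excluded.\<close>

definition adj :: "complex \<times> real \<Rightarrow> complex \<times> real \<Rightarrow> bool" where
  "adj x y \<longleftrightarrow> x \<noteq> y \<and> cmod (fst x - fst y) = \<bar>snd x - snd y\<bar>"

lemma adj_commute: "adj x y \<longleftrightarrow> adj y x"
  by (auto simp: adj_def norm_minus_commute abs_minus_commute)

definition inflate :: "real \<Rightarrow> complex \<times> real \<Rightarrow> plane set" where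
  "inflate R x = sphere (emb (fst x)) (snd x + R)"

text \<open>Inflating all circles by the same large amount preserves internal tangency and destroys
  external tangency.\<close>

lemma tangent_inflate:
  assumes "snd x + R > 0" "snd y + R > 0" "cmod (fst x - fst y) < snd x + snd y + 2 * R"
  shows "tangent (inflate R x) (inflate R y) \<longleftrightarrow> adj x y"
proof -
  have circ: "circle (inflate R x)" "circle (inflate R y)"
    using assms by (auto simp: circle_def inflate_def)
  let ?I = "sphere (fst x) (snd x + R) \<inter> sphere (fst y) (snd y + R)"
  have int: "inflate R x \<inter> inflate R y = emb ` ?I"
    unfolding inflate_def sphere_emb by (rule image_Int[symmetric]) (simp add: inj_def emb_inj)
  have "tangent (inflate R x) (inflate R y) \<longleftrightarrow> (\<exists>p. emb ` ?I = {p})"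
    using circ by (simp add: tangent_def tangent_at_def int)
  also have "\<dots> \<longleftrightarrow> (\<exists>p. ?I = {p})"
  proof -
    have "emb ` ?I = {emb z} \<longleftrightarrow> ?I = {z}" for z
      using inj_image_eq_iff[of emb ?I "{z}"] by (simp add: inj_def emb_inj)
    moreover have "(\<exists>p. emb ` ?I = {p}) \<longleftrightarrow> (\<exists>z. emb ` ?I = {emb z})"
      using surj_emb by (metis surj_def)
    ultimately show ?thesis by (simp only:)
  qed
  also have "\<dots> \<longleftrightarrow> adj x y"
  proof (cases "x = y")
    case True
    have "sphere (fst x) (snd x + R) \<noteq> {p}" for p
      using infinite_circle[OF assms(1)] by (metis finite.emptyI finite.insertI)
    then show ?thesis using True by (simp add: adj_def)
  next
    case False
    then have "(fst x, snd x + R) \<noteq> (fst y, snd y + R)" by (simp add: prod_eq_iff)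
    from single_common_point_iff[OF this assms(1,2)] assms(3) False show ?thesis
      by (simp add: adj_def)
  qed
  finally show ?thesis .
qed

lemma inflate_inj:
  assumes "inflate R x = inflate R y" "snd x + R > 0" "snd y + R > 0"
  shows "x = y"
proof (rule ccontr)
  assume "x \<noteq> y"
  then have "finite (sphere (fst x) (snd x + R) \<inter> sphere (fst y) (snd y + R))"
    by (intro finite_circle_Int) (simp add: prod_eq_iff)
  moreover have "sphere (fst x) (snd x + R) = sphere (fst y) (snd y + R)"
    using assms(1) unfolding inflate_def sphere_emb
    by (subst (asm) inj_image_eq_iff) (auto simp: inj_def emb_inj)
  ultimately show False using infinite_circle[OF assms(2), of "fst x"] by simp
qed

section \<open>Realization by circles\<close>

lemma generic_imp: "(c \<Longrightarrow> generic P) \<Longrightarrow> generic (\<lambda>x. c \<longrightarrow> P x)"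
  by (cases c) (auto simp: generic_def)

lemma lin_diff: "lin n a x - lin n b x = lin n (\<lambda>j. a j - b j) x"
  by (simp add: lin_def sum_subtractf algebra_simps)

lemma lin_scale: "lin n (\<lambda>j. c * a j) x = c * lin n a x"
  by (simp add: lin_def sum_distrib_left algebra_simps)

lemma lin_cong: "(\<And>j. j < n \<Longrightarrow> a j = b j) \<Longrightarrow> lin n a x = lin n b x"
  by (simp add: lin_def)

text \<open>A word \<open>w\<close> is sent to the point \<open>\<Sum>j. x\<^sub>j z\<^bsub>w j\<^esub>\<close>, a circle of radius 0, and a line to a copy of the
  configuration under the similarity of the plane that carries the points \<open>z\<^sub>i\<close> to the points of the
  line; its factor is the sum of the coefficients \<open>x\<^sub>j\<close> at the active positions. As these are complex,
  different lines rotate the configuration differently, so that circles attached at the same point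
  are not tangent to each other.\<close>

lemma realize_attach:
  fixes q :: "nat \<Rightarrow> complex" and \<rho> :: "nat \<Rightarrow> real"
  assumes pos: "\<And>i. i < N \<Longrightarrow> \<rho> i > 0"
    and inj: "\<And>i j. i < N \<Longrightarrow> j < N \<Longrightarrow> (q i, \<rho> i) = (q j, \<rho> j) \<Longrightarrow> i = j"
    and L: "L \<subseteq> lines N n"
  shows "\<exists>f. inj_on f (attach_verts N L) \<and> (\<forall>v\<in>attach_verts N L. snd (f v) \<ge> 0) \<and>
    (\<forall>u\<in>attach_verts N L. \<forall>v\<in>attach_verts N L.
       adj (f u) (f v) \<longleftrightarrow> attach (\<lambda>i j. adj (q i, \<rho> i) (q j, \<rho> j)) u v)"
proof -
  define W where "W = \<Union>(pts N ` L)"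
  have W: "w \<in> words N n" if w: "w \<in> W" for w
  proof -
    obtain \<tau> a where "\<tau> \<in> L" "a < N" "w = inst \<tau> a" using w by (auto simp: W_def pts_def)
    then show ?thesis using inst_in_words[of \<tau> N n a] L by auto
  qed
  have finL: "finite L" using L finite_lines finite_subset by blast
  have finW: "finite W" using finL by (simp add: W_def pts_def)
  have "\<exists>z. cmod (z - q i) = \<rho> i \<and> (\<forall>j<N. j \<noteq> i \<longrightarrow> cmod (z - q j) \<noteq> \<rho> j)" if i: "i < N" for i
  proof -
    have *: "finite ((\<lambda>j. (q j, \<rho> j)) ` {..<N})" "(q i, \<rho> i) \<in> (\<lambda>j. (q j, \<rho> j)) ` {..<N}"
      using i by auto
    obtain z where z: "cmod (z - q i) = \<rho> i"
      "\<forall>c\<in>(\<lambda>j. (q j, \<rho> j)) ` {..<N} - {(q i, \<rho> i)}. cmod (z - fst c) \<noteq> snd c"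
      using exists_private_point[OF * pos[OF i]] by blast
    have "cmod (z - q j) \<noteq> \<rho> j" if "j < N" "j \<noteq> i" for j
    proof -
      have "(q j, \<rho> j) \<in> (\<lambda>j. (q j, \<rho> j)) ` {..<N} - {(q i, \<rho> i)}"
        using that i inj[of j i] by auto
      from bspec[OF z(2) this] show ?thesis by simp
    qed
    then show ?thesis using z(1) by blast
  qed
  then obtain z where z: "\<And>i. i < N \<Longrightarrow> cmod (z i - q i) = \<rho> i"
    "\<And>i j. i < N \<Longrightarrow> j < N \<Longrightarrow> i \<noteq> j \<Longrightarrow> cmod (z i - q j) \<noteq> \<rho> j" by metis
  have zinj: "z i \<noteq> z j" if "i < N" "j < N" "i \<noteq> j" for i j
    using z that by metis
  define J where "J \<tau> = {j. j < n \<and> \<tau> ! j = None}" for \<tau> :: "nat option list"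
  have J: "J \<tau> \<subseteq> {..<n}" "J \<tau> \<noteq> {}" if "\<tau> \<in> L" for \<tau>
    using that L by (auto simp: J_def lines_def in_set_conv_nth)
  \<comment> \<open>Coefficient vectors of the point \<open>w\<close> and of the centre of the
    \<open>i\<close>-th circle on \<open>\<tau>\<close>. Since active positions contribute
    \<open>q i\<close> where the point \<open>inst \<tau> i\<close> has \<open>z i\<close>, the copy
    is similar to the original with factor \<open>lin n (?I \<tau>) x\<close>.\<close>
  define wc where "wc w j = z (w ! j)" for w :: "nat list" and j
  define lc where "lc \<tau> i j = (case \<tau> ! j of None \<Rightarrow> q i | Some a \<Rightarrow> z a)" for \<tau> i j
  let ?I = "\<lambda>\<tau>. indicator (J \<tau>) :: nat \<Rightarrow> complex"
  have len: "length \<tau> = n" if "\<tau> \<in> L" for \<tau> using that L by (auto simp: lines_def)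
  have lenW: "length w = n" if "w \<in> W" for w using W[OF that] by (simp add: words_def)
  have ltW: "w ! j < N" if "w \<in> W" "j < n" for w j
  proof -
    have "w ! j \<in> set w" using that lenW by simp
    then show ?thesis using W[OF that(1)] by (auto simp: words_def)
  qed
  have ltL: "a < N" if "\<tau> \<in> L" "j < n" "\<tau> ! j = Some a" for \<tau> j a
    by (rule lines_nth_cases[of \<tau> N n j]) (use that L in auto)

  define nondegenerate where "nondegenerate x \<longleftrightarrow> (\<forall>\<tau>\<in>L. lin n (?I \<tau>) x \<noteq> 0)" for x
  have 0: "generic nondegenerate"
    unfolding nondegenerate_def by (intro generic_Ball finL generic_lin_indicator_nonzero J)

  \<comment> \<open>Distinctness is phrased as a comparison with the zero form to fit
    \<open>generic_norm_lin_neq\<close>.\<close>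
  define PP where "PP x \<longleftrightarrow> (\<forall>w\<in>W. \<forall>w'\<in>W. w \<noteq> w' \<longrightarrow>
      cmod (lin n (\<lambda>j. wc w j - wc w' j) x) \<noteq> cmod (lin n (\<lambda>_. 0) x))" for x
  have 1: "generic PP"
    unfolding PP_def
  proof (intro generic_Ball finW generic_imp)
    fix w w' assume w: "w \<in> W" "w' \<in> W" "w \<noteq> w'"
    then obtain j where j: "j < n" "w ! j \<noteq> w' ! j" using lenW nth_equalityI by metis
    have "z (w ! j) \<noteq> z (w' ! j)" by (rule zinj) (use w j ltW in auto)
    then show "generic (\<lambda>x. cmod (lin n (\<lambda>j. wc w j - wc w' j) x) \<noteq> cmod (lin n (\<lambda>_. 0) x))"
      by (intro generic_norm_lin_neq[OF j(1)]) (simp add: wc_def)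
  qed

  define PC where "PC x \<longleftrightarrow> (\<forall>w\<in>W. \<forall>\<tau>\<in>L. \<forall>i\<in>{..<N}. w \<noteq> inst \<tau> i \<longrightarrow>
      cmod (lin n (\<lambda>j. wc w j - lc \<tau> i j) x) \<noteq> cmod (lin n (\<lambda>j. of_real (\<rho> i) * ?I \<tau> j) x))" for x
  have 2: "generic PC"
    unfolding PC_def
  proof (intro generic_Ball finW finL finite_lessThan generic_imp)
    fix w \<tau> i assume w: "w \<in> W" "\<tau> \<in> L" "i \<in> {..<N}" "w \<noteq> inst \<tau> i"
    then obtain j where j: "j < n" "w ! j \<noteq> inst \<tau> i ! j" using lenW len nth_equalityI length_inst by metis
    have "cmod (wc w j - lc \<tau> i j) \<noteq> cmod (of_real (\<rho> i) * ?I \<tau> j)"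
    proof (cases "\<tau> ! j")
      case None
      then have "w ! j \<noteq> i" using j len[OF w(2)] by (simp add: inst_nth)
      \<comment> \<open>Here the private choice of \<open>z\<close> enters: the point of another
        letter is off the \<open>i\<close>-th circle.\<close>
      then have "cmod (z (w ! j) - q i) \<noteq> \<rho> i" using z(2) ltW[OF w(1) j(1)] w(3) by simp
      then show ?thesis using None j(1) pos[of i] w(3) by (simp add: wc_def lc_def J_def)
    next
      case (Some a)
      then have "w ! j \<noteq> a" using j len[OF w(2)] by (simp add: inst_nth)
      then have "z (w ! j) \<noteq> z a" using zinj ltW[OF w(1) j(1)] ltL[OF w(2) j(1) Some] by simp
      then show ?thesis using Some by (simp add: wc_def lc_def J_def)
    qed
    then show "generic (\<lambda>x. cmod (lin n (\<lambda>j. wc w j - lc \<tau> i j) x) \<noteq> cmod (lin n (\<lambda>j. of_real (\<rho> i) * ?I \<tau> j) x))"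
      by (rule generic_norm_lin_neq[OF j(1)])
  qed

  \<comment> \<open>Equal active sets give equal scale factors, so the difference of radii is, up to
    sign, the norm of a linear form.\<close>
  define CC where "CC x \<longleftrightarrow> (\<forall>\<tau>\<in>L. \<forall>\<tau>'\<in>L. \<forall>i\<in>{..<N}. \<forall>i'\<in>{..<N}. \<tau> \<noteq> \<tau>' \<and> J \<tau> = J \<tau>' \<longrightarrow>
      cmod (lin n (\<lambda>j. lc \<tau> i j - lc \<tau>' i' j) x) \<noteq> cmod (lin n (\<lambda>j. of_real (\<rho> i - \<rho> i') * ?I \<tau> j) x))" for x
  have 3: "generic CC"
    unfolding CC_def
  proof (intro generic_Ball finW finL finite_lessThan generic_imp)
    fix \<tau> \<tau>' i i' assume t: "\<tau> \<in> L" "\<tau>' \<in> L" "i \<in> {..<N}" "i' \<in> {..<N}" "\<tau> \<noteq> \<tau>' \<and> J \<tau> = J \<tau>'"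
    then obtain j where j: "j < n" "\<tau> ! j \<noteq> \<tau>' ! j" using len nth_equalityI by metis
    have "j \<in> J \<tau> \<longleftrightarrow> j \<in> J \<tau>'" using t(5) by simp
    then have "\<tau> ! j = None \<longleftrightarrow> \<tau>' ! j = None" using j(1) by (simp add: J_def)
    then obtain a b where ab: "\<tau> ! j = Some a" "\<tau>' ! j = Some b" using j(2) by (cases "\<tau> ! j") auto
    have "z a \<noteq> z b" by (rule zinj) (use ab j t(1,2) ltL in auto)
    then have "cmod (lc \<tau> i j - lc \<tau>' i' j) \<noteq> cmod (of_real (\<rho> i - \<rho> i') * ?I \<tau> j)"
      using ab by (simp add: lc_def J_def)
    then show "generic (\<lambda>x. cmod (lin n (\<lambda>j. lc \<tau> i j - lc \<tau>' i' j) x) \<noteq>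
        cmod (lin n (\<lambda>j. of_real (\<rho> i - \<rho> i') * ?I \<tau> j) x))"
      by (rule generic_norm_lin_neq[OF j(1)])
  qed

  \<comment> \<open>With different active sets two different norms enter the radii; squaring removes
    the absolute value from the tangency condition.\<close>
  define CR where "CR x \<longleftrightarrow> (\<forall>\<tau>\<in>L. \<forall>\<tau>'\<in>L. \<forall>i\<in>{..<N}. \<forall>i'\<in>{..<N}. J \<tau> \<noteq> J \<tau>' \<longrightarrow>
      (cmod (lin n (\<lambda>j. lc \<tau> i j - lc \<tau>' i' j) x))\<^sup>2 \<noteq>
      (\<rho> i * cmod (lin n (?I \<tau>) x) - \<rho> i' * cmod (lin n (?I \<tau>') x))\<^sup>2)" for x
  have 4: "generic CR"
    unfolding CR_def by (intro generic_Ball finW finL finite_lessThan generic_imp generic_tangency J pos) auto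

  have "generic (\<lambda>x. nondegenerate x \<and> PP x \<and> PC x \<and> CC x \<and> CR x)"
    by (intro generic_conj 0 1 2 3 4)
  then obtain x where x: "nondegenerate x" "PP x" "PC x" "CC x" "CR x"
    unfolding generic_def by (metis UNIV_not_empty open_UNIV)

  define f where "f v = (case v of Inl w \<Rightarrow> (lin n (wc w) x, 0)
      | Inr (\<tau>, i) \<Rightarrow> (lin n (lc \<tau> i) x, \<rho> i * cmod (lin n (?I \<tau>) x)))" for v
  have fI: "f (Inl w) = (lin n (wc w) x, 0)" for w by (simp add: f_def)
  have fR: "f (Inr (\<tau>, i)) = (lin n (lc \<tau> i) x, \<rho> i * cmod (lin n (?I \<tau>) x))" for \<tau> i by (simp add: f_def)
  have nz: "lin n (?I \<tau>) x \<noteq> 0" if "\<tau> \<in> L" for \<tau> using x(1) that by (simp add: nondegenerate_def)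
  have same: "lin n (\<lambda>j. lc \<tau> i j - lc \<tau> i' j) x = (q i - q i') * lin n (?I \<tau>) x" for \<tau> i i'
    unfolding lin_scale[symmetric] by (rule lin_cong) (auto simp: lc_def J_def split: option.splits)
  have on: "lin n (\<lambda>j. wc (inst \<tau> i) j - lc \<tau> i j) x = (z i - q i) * lin n (?I \<tau>) x" if "\<tau> \<in> L" for \<tau> i
    unfolding lin_scale[symmetric]
    by (rule lin_cong) (use len[OF that] in \<open>auto simp: wc_def lc_def J_def inst_nth split: option.splits\<close>)

  have II: "f (Inl w) \<noteq> f (Inl w')" "\<not> adj (f (Inl w)) (f (Inl w'))"
    if "w \<in> W" "w' \<in> W" "w \<noteq> w'" for w w'
  proof -
    have "cmod (lin n (\<lambda>j. wc w j - wc w' j) x) \<noteq> 0"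
      using x(2) that by (simp add: PP_def lin_def)
    then have "lin n (wc w) x - lin n (wc w') x \<noteq> 0" by (simp add: lin_diff)
    then show "f (Inl w) \<noteq> f (Inl w')" "\<not> adj (f (Inl w)) (f (Inl w'))"
      by (auto simp: fI adj_def)
  qed
  have IR: "f (Inl w) \<noteq> f (Inr (\<tau>, i))" "adj (f (Inl w)) (f (Inr (\<tau>, i))) \<longleftrightarrow> w = inst \<tau> i"
    if "w \<in> W" "\<tau> \<in> L" "i < N" for w \<tau> i
  proof -
    have p: "\<rho> i * cmod (lin n (?I \<tau>) x) > 0" using pos that nz by simp
    show ne: "f (Inl w) \<noteq> f (Inr (\<tau>, i))"
    proof
      assume "f (Inl w) = f (Inr (\<tau>, i))"
      then have "0 = \<rho> i * cmod (lin n (?I \<tau>) x)" unfolding fI fR by (simp only: prod.inject)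
      then show False using p by linarith
    qed
    have r: "cmod (lin n (\<lambda>j. of_real (\<rho> i) * ?I \<tau> j) x) = \<rho> i * cmod (lin n (?I \<tau>) x)"
      using pos[OF that(3)] by (simp add: lin_scale norm_mult)
    have "adj (f (Inl w)) (f (Inr (\<tau>, i))) \<longleftrightarrow>
        cmod (lin n (\<lambda>j. wc w j - lc \<tau> i j) x) = \<rho> i * cmod (lin n (?I \<tau>) x)"
      using ne p by (simp add: adj_def fI fR lin_diff)
    also have "\<dots> \<longleftrightarrow> w = inst \<tau> i"
    proof (cases "w = inst \<tau> i")
      case True
      then show ?thesis using on[OF that(2)] z(1)[OF that(3)] by (simp add: norm_mult)
    next
      case False
      then show ?thesis using x(3) that unfolding PC_def r[symmetric] by simp
    qed
    finally show "adj (f (Inl w)) (f (Inr (\<tau>, i))) \<longleftrightarrow> w = inst \<tau> i" .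
  qed
  have RR: "f (Inr (\<tau>, i)) = f (Inr (\<tau>', i')) \<longleftrightarrow> \<tau> = \<tau>' \<and> i = i'"
    "adj (f (Inr (\<tau>, i))) (f (Inr (\<tau>', i'))) \<longleftrightarrow> \<tau> = \<tau>' \<and> adj (q i, \<rho> i) (q i', \<rho> i')"
    if t: "\<tau> \<in> L" "\<tau>' \<in> L" "i < N" "i' < N" for \<tau> \<tau>' i i'
  proof -
    let ?d = "cmod (lin n (\<lambda>j. lc \<tau> i j - lc \<tau>' i' j) x)"
    let ?r = "\<bar>\<rho> i * cmod (lin n (?I \<tau>) x) - \<rho> i' * cmod (lin n (?I \<tau>') x)\<bar>"
    have d: "cmod (fst (f (Inr (\<tau>, i))) - fst (f (Inr (\<tau>', i')))) = ?d"
      "\<bar>snd (f (Inr (\<tau>, i))) - snd (f (Inr (\<tau>', i')))\<bar> = ?r"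
      by (simp_all add: fR lin_diff)
    have "(f (Inr (\<tau>, i)) = f (Inr (\<tau>', i')) \<longleftrightarrow> \<tau> = \<tau>' \<and> i = i') \<and>
      (adj (f (Inr (\<tau>, i))) (f (Inr (\<tau>', i'))) \<longleftrightarrow> \<tau> = \<tau>' \<and> adj (q i, \<rho> i) (q i', \<rho> i'))"
    proof (cases "\<tau> = \<tau>'")
      case True
      let ?l = "cmod (lin n (?I \<tau>) x)"
      have l: "?l > 0" using nz t by simp
      have dl: "?d = cmod (q i - q i') * ?l" using True by (simp add: same norm_mult)
      have rl: "?r = \<bar>\<rho> i - \<rho> i'\<bar> * ?l"
        using True by (simp add: abs_mult flip: left_diff_distrib)
      have eq: "f (Inr (\<tau>, i)) = f (Inr (\<tau>', i')) \<longleftrightarrow> i = i'"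
      proof
        assume e: "f (Inr (\<tau>, i)) = f (Inr (\<tau>', i'))"
        then have "?d = 0" "?r = 0" using d by auto
        then have "q i = q i'" "\<rho> i = \<rho> i'" unfolding dl rl using l by auto
        then show "i = i'" using inj t by simp
      qed (use True in simp)
      have "(q i, \<rho> i) = (q i', \<rho> i') \<longleftrightarrow> i = i'" using inj t by blast
      then have "adj (f (Inr (\<tau>, i))) (f (Inr (\<tau>', i'))) \<longleftrightarrow> adj (q i, \<rho> i) (q i', \<rho> i')"
        unfolding adj_def d dl rl eq using l by simp
      then show ?thesis using eq True by simp
    next
      case False
      have "?d \<noteq> ?r"
      proof (cases "J \<tau> = J \<tau>'")
        case True
        then have "?r = cmod (lin n (\<lambda>j. of_real (\<rho> i - \<rho> i') * ?I \<tau> j) x)"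
          unfolding lin_scale norm_mult norm_of_real
          by (simp add: abs_mult flip: left_diff_distrib)
        then show ?thesis using x(4) t False True unfolding CC_def by simp
      next
        case False
        then have "?d\<^sup>2 \<noteq> (\<rho> i * cmod (lin n (?I \<tau>) x) - \<rho> i' * cmod (lin n (?I \<tau>') x))\<^sup>2"
          using x(5) t unfolding CR_def by blast
        then show ?thesis by (metis power2_abs)
      qed
      then have "f (Inr (\<tau>, i)) \<noteq> f (Inr (\<tau>', i'))" "\<not> adj (f (Inr (\<tau>, i))) (f (Inr (\<tau>', i')))"
        using d by (auto simp: adj_def)
      then show ?thesis using False by simp
    qed
    then show "f (Inr (\<tau>, i)) = f (Inr (\<tau>', i')) \<longleftrightarrow> \<tau> = \<tau>' \<and> i = i'"
      "adj (f (Inr (\<tau>, i))) (f (Inr (\<tau>', i'))) \<longleftrightarrow> \<tau> = \<tau>' \<and> adj (q i, \<rho> i) (q i', \<rho> i')"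
      by simp_all
  qed
  have cases: thesis' if "v \<in> attach_verts N L" "\<And>w. v = Inl w \<Longrightarrow> w \<in> W \<Longrightarrow> thesis'"
    "\<And>\<tau> i. v = Inr (\<tau>, i) \<Longrightarrow> \<tau> \<in> L \<Longrightarrow> i < N \<Longrightarrow> thesis'" for v thesis'
    using that unfolding attach_verts_def W_def by blast
  show ?thesis
  proof (intro exI[of _ f] conjI ballI)
    show "inj_on f (attach_verts N L)"
    proof (rule inj_onI)
      fix u v assume u: "u \<in> attach_verts N L" and v: "v \<in> attach_verts N L" and "f u = f v"
      show "u = v"
      proof (rule cases[OF u]; rule cases[OF v])
        fix w w' assume "u = Inl w" "w \<in> W" "v = Inl w'" "w' \<in> W"
        then show ?thesis using II(1)[of w w'] \<open>f u = f v\<close> by blast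
      next
        fix w \<tau> i assume "u = Inl w" "w \<in> W" "v = Inr (\<tau>, i)" "\<tau> \<in> L" "i < N"
        then show ?thesis using IR(1)[of w \<tau> i] \<open>f u = f v\<close> by simp
      next
        fix w \<tau> i assume "u = Inr (\<tau>, i)" "\<tau> \<in> L" "i < N" "v = Inl w" "w \<in> W"
        then show ?thesis using IR(1)[of w \<tau> i] \<open>f u = f v\<close> by simp
      next
        fix \<tau> i \<tau>' i' assume "u = Inr (\<tau>, i)" "\<tau> \<in> L" "i < N" "v = Inr (\<tau>', i')" "\<tau>' \<in> L" "i' < N"
        then show ?thesis using RR(1)[of \<tau> \<tau>' i i'] \<open>f u = f v\<close> by simp
      qed
    qed
    show "snd (f v) \<ge> 0" if "v \<in> attach_verts N L" for v
      by (rule cases[OF that]) (use pos in \<open>auto simp: fI fR less_imp_le\<close>)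
    fix u v assume u: "u \<in> attach_verts N L" and v: "v \<in> attach_verts N L"
    show "adj (f u) (f v) \<longleftrightarrow> attach (\<lambda>i j. adj (q i, \<rho> i) (q j, \<rho> j)) u v"
    proof (rule cases[OF u]; rule cases[OF v])
      fix w w' assume "u = Inl w" "w \<in> W" "v = Inl w'" "w' \<in> W"
      then show ?thesis using II(2)[of w w'] by (cases "w = w'") (auto simp: adj_def)
    next
      fix w \<tau> i assume "u = Inl w" "w \<in> W" "v = Inr (\<tau>, i)" "\<tau> \<in> L" "i < N"
      then show ?thesis using IR(2) by simp
    next
      fix w \<tau> i assume "u = Inr (\<tau>, i)" "\<tau> \<in> L" "i < N" "v = Inl w" "w \<in> W"
      then show ?thesis using IR(2)[of w \<tau> i] adj_commute[of "f u"] by simp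
    next
      fix \<tau> i \<tau>' i' assume "u = Inr (\<tau>, i)" "\<tau> \<in> L" "i < N" "v = Inr (\<tau>', i')" "\<tau>' \<in> L" "i' < N"
      then show ?thesis using RR(2) by simp
    qed
  qed
qed

text \<open>Positive radii are part of the induction because a private point can only be found on an
  infinite circle.\<close>

theorem exists_thin_noncolourable:
  "\<exists>C. finite C \<and> (\<forall>c\<in>C. snd c > 0) \<and> thin g C adj \<and> \<not> colourable k C adj"
proof (induction k)
  case 0
  have "\<exists>v\<in>S. \<exists>p. \<forall>u\<in>S. adj v u \<longrightarrow> u = p" if "S \<subseteq> {(0, 1)}" "S \<noteq> {}" for S
    using that by (metis singletonD subset_singletonD singletonI)
  then have "thin g {(0, 1)} adj" by (simp add: thin_def)
  moreover have "\<not> colourable 0 {(0, 1)} adj" by (simp add: colourable_def)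
  ultimately show ?case by (intro exI[of _ "{(0, 1)}"]) simp
next
  case (Suc k)
  then obtain C where C: "finite C" "\<forall>c\<in>C. snd c > 0" "thin g C adj" "\<not> colourable k C adj" by blast
  define N where "N = card C"
  obtain e where e: "bij_betw e {..<N} C"
    using ex_bij_betw_nat_finite[OF C(1)] by (auto simp: N_def atLeast0LessThan)
  define q \<rho> where "q i = fst (e i)" and "\<rho> i = snd (e i)" for i
  have qr: "(q i, \<rho> i) = e i" for i by (simp add: q_def \<rho>_def)
  let ?A = "\<lambda>i j. adj (q i, \<rho> i) (q j, \<rho> j)"
  have einj: "inj_on e {..<N}" and eC: "e ` {..<N} = C" using e by (auto simp: bij_betw_def)
  let ?e' = "inv_into {..<N} e"
  have e': "?e' ` C = {..<N}" "inj_on ?e' C"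
    using bij_betw_inv_into[OF e] by (auto simp: bij_betw_def)
  have ee': "e (?e' c) = c" if "c \<in> C" for c
    using that eC by (metis f_inv_into_f)
  have A: "?A (?e' c) (?e' d) \<longleftrightarrow> adj c d" if "c \<in> C" "d \<in> C" for c d
    unfolding qr ee'[OF that(1)] ee'[OF that(2)] ..
  have thinA: "thin g {..<N} ?A"
    using thin_image[where B = ?A, OF C(3) e'(2) A] e'(1) by simp
  have ncA: "\<not> colourable k {..<N} ?A"
  proof
    assume "colourable k {..<N} ?A"
    then have "colourable k (?e' ` C) ?A" by (simp only: e'(1))
    then have "colourable k C adj" by (rule colourable_image) (simp only: A)
    then show False using C(4) by blast
  qed
  obtain n L where L: "L \<subseteq> lines N n" "sparse (pts N) g L"
    "\<forall>c :: nat list \<Rightarrow> nat. (\<forall>x. c x < Suc k) \<longrightarrow> (\<exists>\<tau>\<in>L. mono_line N c \<tau>)"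
    using sparse_hales_jewett[of g, unfolded sparse_HJ_def, THEN spec, THEN spec, of N "Suc k"]
    by (elim exE conjE)
  have pos: "\<rho> i > 0" if "i < N" for i using C(2) eC that by (auto simp: \<rho>_def)
  have inj: "i = j" if "i < N" "j < N" "(q i, \<rho> i) = (q j, \<rho> j)" for i j
    using inj_onD[OF einj, of i j] that unfolding qr by simp
  let ?V = "attach_verts N L"
  obtain f where f: "inj_on f ?V" "\<forall>v\<in>?V. snd (f v) \<ge> 0"
    "\<forall>u\<in>?V. \<forall>v\<in>?V. adj (f u) (f v) \<longleftrightarrow> attach ?A u v"
  proof -
    have "\<exists>f. inj_on f ?V \<and> (\<forall>v\<in>?V. snd (f v) \<ge> 0) \<and>
        (\<forall>u\<in>?V. \<forall>v\<in>?V. adj (f u) (f v) \<longleftrightarrow> attach ?A u v)"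
      by (rule realize_attach[OF _ _ L(1)]) (fact pos, fact inj)
    then show thesis using that by blast
  qed
  \<comment> \<open>Any positive constant would do: the points of radius 0 become circles and
    adjacency is unchanged.\<close>
  define h where "h v = (fst (f v), snd (f v) + 1)" for v
  have h: "adj (h u) (h v) \<longleftrightarrow> attach ?A u v" if "u \<in> ?V" "v \<in> ?V" for u v
  proof -
    have "adj (h u) (h v) \<longleftrightarrow> adj (f u) (f v)" by (simp add: h_def adj_def prod_eq_iff)
    then show ?thesis using f(3) that by simp
  qed
  have "inj_on h ?V" using f(1) by (auto simp: h_def inj_on_def prod_eq_iff)
  have thinV: "thin g ?V (attach ?A)"
    by (rule thin_attach[OF thinA _ _ L(1,2)]) (simp add: adj_def, simp add: adj_commute)
  show ?case
  proof (intro exI[of _ "h ` ?V"] conjI ballI)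
    show "finite (h ` ?V)"
      using L(1) finite_lines finite_subset finite_attach_verts by blast
    show "snd c > 0" if "c \<in> h ` ?V" for c using that f(2) by (fastforce simp: h_def)
    show "thin g (h ` ?V) adj" by (rule thin_image[OF thinV \<open>inj_on h ?V\<close> h])
    have "\<not> colourable (Suc k) ?V (attach ?A)" by (rule not_colourable_attach[OF ncA L(3)[rule_format]]) simp
    then show "\<not> colourable (Suc k) (h ` ?V) adj" using colourable_image h by blast
  qed
qed

section \<open>From adjacent pairs to constellations\<close>

lemma tangent_commute: "tangent A B \<longleftrightarrow> tangent B A"
  by (auto simp: tangent_def tangent_at_def Int_commute)

text \<open>The vertex set of a cycle has no vertex with at most one neighbour, so
  \<open>thin\<close> forbids it below size \<open>g\<close>.\<close>

lemma no_short_cycles: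
  assumes thin: "thin g \<C> tangent" and c: "is_cycle (tangency_graph \<C>) xs"
  shows "g \<le> length xs"
proof (rule ccontr)
  assume "\<not> g \<le> length xs"
  define m where "m = length xs"
  have m: "m \<ge> 3" "m < g" and xs: "distinct xs" "set xs \<subseteq> \<C>"
    and ed: "\<And>i. i < m \<Longrightarrow> {xs ! i, xs ! (Suc i mod m)} \<in> edges (tangency_graph \<C>)"
    using c \<open>\<not> g \<le> length xs\<close> by (auto simp: is_cycle_def m_def verts_def tangency_graph_def)
  have tan: "tangent (xs ! i) (xs ! (Suc i mod m))" if "i < m" for i
    using ed[OF that] tangent_commute by (auto simp: edges_def tangency_graph_def doubleton_eq_iff)
  have "card (set xs) < g" using distinct_card[OF xs(1)] m by (simp add: m_def)
  moreover have "set xs \<noteq> {}" using m(1) by (auto simp: m_def)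
  ultimately obtain v p where v: "v \<in> set xs" "\<And>u. u \<in> set xs \<Longrightarrow> tangent v u \<Longrightarrow> u = p"
    using thin xs(2) unfolding thin_def by (metis List.finite_set)
  obtain i where i: "i < m" "v = xs ! i" using v(1) by (metis in_set_conv_nth m_def)
  \<comment> \<open>Successor and predecessor of \<open>i\<close> on the cycle; they differ because
    \<open>m \<ge> 3\<close>.\<close>
  define s r where "s = Suc i mod m" and "r = (if i = 0 then m - 1 else i - 1)"
  have sr: "s < m" "r < m" "Suc r mod m = i" using i m by (auto simp: s_def r_def)
  have "s \<noteq> r" using i m by (cases "Suc i = m") (auto simp: s_def r_def split: if_splits)
  have "xs ! s = p"
    by (rule v(2)) (use tan[OF i(1)] i sr in \<open>auto simp: s_def m_def\<close>)
  moreover have "xs ! r = p"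
  proof (rule v(2))
    show "xs ! r \<in> set xs" using sr by (simp add: m_def)
    show "tangent v (xs ! r)" using tan[OF sr(2)] tangent_commute unfolding sr(3) i(2) by blast
  qed
  ultimately show False using \<open>s \<noteq> r\<close> sr xs(1) by (auto simp: m_def nth_eq_iff_index_eq)
qed

lemma thin_imp_constellation:
  assumes fin: "finite \<C>" and circ: "\<forall>A\<in>\<C>. circle A" and thin: "thin g \<C> tangent" and g: "g > 3"
  shows "constellation \<C>"
proof -
  have False if ABD: "A \<in> \<C>" "B \<in> \<C>" "D \<in> \<C>" and ne: "A \<noteq> B" "A \<noteq> D" "B \<noteq> D"
    and at: "tangent_at p A B" "tangent_at p A D" "tangent_at p B D" for A B D p
  proof -
    have t: "tangent A B" "tangent A D" "tangent B D" using at by (auto simp: tangent_def)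
    have "card {A, B, D} < g" using ne g by simp
    then obtain v x where "v \<in> {A, B, D}" and x: "\<And>u. u \<in> {A, B, D} \<Longrightarrow> tangent v u \<Longrightarrow> u = x"
      using thin ABD unfolding thin_def
      by (metis empty_subsetI finite.emptyI finite.insertI insert_not_empty insert_subset)
    then show False using t ne tangent_commute by (metis insertCI insertE singletonD)
  qed
  then show ?thesis using fin circ unfolding constellation_def by blast
qed

theorem theorem1:
  fixes g k :: nat
  assumes "g > 0" and "k > 0"
  shows "\<exists>\<C>. constellation \<C> \<and> girth (tangency_graph \<C>) \<ge> enat g \<and>
           chromatic_number (tangency_graph \<C>) \<ge> enat k"
proof -
  \<comment> \<open>The summand 4 excludes triangles even for small \<open>g\<close>, as
    \<open>thin_imp_constellation\<close> requires.\<close>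
  obtain C where C: "finite C" "\<forall>c\<in>C. snd c > 0" "thin (g + 4) C adj" "\<not> colourable k C adj"
    using exists_thin_noncolourable by blast
  \<comment> \<open>A common bound on the norms of the centres: any two are at most
    \<open>2 * R\<close> apart, less than the sum of two inflated radii.\<close>
  define R where "R = (\<Sum>c\<in>C. cmod (fst c))"
  have R: "cmod (fst c) \<le> R" if "c \<in> C" for c
    unfolding R_def using C(1) that by (intro member_le_sum) auto
  have R0: "R \<ge> 0" unfolding R_def by (intro sum_nonneg) simp
  have close: "cmod (fst c - fst d) < snd c + snd d + 2 * R" if "c \<in> C" "d \<in> C" for c d
  proof -
    have "snd c > 0" "snd d > 0" using C(2) that by auto
    then show ?thesis
      using norm_triangle_ineq4[of "fst c" "fst d"] R[OF that(1)] R[OF that(2)] by linarith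
  qed
  have pos: "snd c + R > 0" if "c \<in> C" for c using C(2) R0 that by (simp add: add_pos_nonneg)
  have tan: "tangent (inflate R c) (inflate R d) \<longleftrightarrow> adj c d" if "c \<in> C" "d \<in> C" for c d
    by (rule tangent_inflate) (use that pos close in auto)
  define \<C> where "\<C> = inflate R ` C"
  have inj: "inj_on (inflate R) C" using inflate_inj pos by (meson inj_onI)
  have thin: "thin (g + 4) \<C> tangent"
    unfolding \<C>_def by (rule thin_image[OF C(3) inj tan])
  have "\<forall>A\<in>\<C>. circle A" using pos by (auto simp: \<C>_def circle_def inflate_def)
  then have "constellation \<C>"
    using thin_imp_constellation[OF _ _ thin] C(1) by (simp add: \<C>_def)
  moreover have "enat g \<le> girth (tangency_graph \<C>)"
    unfolding girth_def by (rule Inf_greatest) (auto dest!: no_short_cycles[OF thin])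
  moreover have "enat k \<le> chromatic_number (tangency_graph \<C>)"
    unfolding chromatic_number_def
  proof (rule Inf_greatest, clarify)
    fix m f assume f: "proper_colouring (tangency_graph \<C>) m f"
    show "enat k \<le> enat m"
    proof (rule ccontr)
      assume "\<not> enat k \<le> enat m"
      then have "m < k" by simp
      have "colourable k \<C> tangent"
        unfolding colourable_def
      proof (intro exI[of _ f] conjI ballI impI)
        show "f v < k" if "v \<in> \<C>" for v
          using f that \<open>m < k\<close> by (auto simp: proper_colouring_def tangency_graph_def verts_def intro: less_trans)
        fix u v assume uv: "u \<in> \<C>" "v \<in> \<C>" "tangent u v"
        then have "{u, v} \<in> edges (tangency_graph \<C>)"
          unfolding tangency_graph_def edges_def by auto
        then show "f u \<noteq> f v"
          using f uv unfolding proper_colouring_def by (simp add: tangency_graph_def verts_def)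
      qed
      then have "colourable k C adj"
        unfolding \<C>_def by (rule colourable_image) (simp add: tan)
      then show False using C(4) by blast
    qed
  qed
  ultimately show ?thesis by blast
qed

end
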